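(* Let $\boldsymbol u\in [L^2_{\rm loc}(\mathbb{R}^3)]^3$ be such that the pair $(\boldsymbol u,p)$ with $p=-\frac{|\boldsymbol u|^2}{2}$ is a weak solution of the stationary Euler equations, i.e. \[ \int_{\mathbb{R}^3}\sum_{i,j=1}^3 u_i u_j\,\partial_j\varphi_i\,dx=-\int_{\mathbb{R}^3}p\,\nabla\cdot\boldsymbol\varphi\,dx\quad\text{for all }\boldsymbol\varphi\in[C^\infty_{\rm c}(\mathbb{R}^3)]^3 . \] Then \[ \int_{B_R}\frac{|\boldsymbol u_N|^2}{|x|}\,dx\le \frac{1}{2R}\int_{B_R}|\boldsymbol u|^2\,dx\quad\text{for all }0<R<+\infty . \] Moreover, if there exists a sequence $R_k\to+\infty$ such that \[ \int_{\partial B_{R_k}}|\boldsymbol u_T|^2\,dS\to 0\quad\text{as }k\to+\infty, \] then $\boldsymbol u\equiv 0$.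
   Context: $B_R$ denotes the open ball of radius $R$ centered at the origin in $\mathbb{R}^3$, and $dS$ the two-dimensional surface measure on $\partial B_R$. For a vector field $\boldsymbol u$ on $\mathbb{R}^3$, the normal and tangential parts are defined (a.e.) by $\boldsymbol u_N=\big(\boldsymbol u\cdot\frac{x}{|x|}\big)\frac{x}{|x|}$ and $\boldsymbol u_T=\boldsymbol u\times\frac{x}{|x|}$. A weak solution $(\boldsymbol u,p)\in[L^2_{\rm loc}(\mathbb{R}^3)]^3\times L^1_{\rm loc}(\mathbb{R}^3)$ satisfying $p=-\frac{|\boldsymbol u|^2}{2}$ a.e. is called a weak Beltrami flow.
   Formalization: Since sphere integrals of an L²_loc field are defined only for a.e. radius, the "moreover" hypothesis is read as: for every Lebesgue-null set N of radii there is a sequence R_k→∞ avoiding N with ∫_{∂B_{R_k}}|u_T|² dS→0; "u≡0" means u=0 a.e. *)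

theory Defs
  imports "HOL-Analysis.Analysis" "HOL-Analysis.Cross3"
begin

definition partial :: "3 \<Rightarrow> (real^3 \<Rightarrow> real) \<Rightarrow> real^3 \<Rightarrow> real" where
  "partial j f x = frechet_derivative f (at x) (axis j 1)"

primrec iter_partial :: "3 list \<Rightarrow> (real^3 \<Rightarrow> real) \<Rightarrow> (real^3 \<Rightarrow> real)" where
  "iter_partial [] f = f"
| "iter_partial (j # js) f = partial j (iter_partial js f)"

definition smooth :: "(real^3 \<Rightarrow> real) \<Rightarrow> bool" where
  "smooth f \<longleftrightarrow> (\<forall>js x. iter_partial js f differentiable (at x))"

definition test_field :: "(real^3 \<Rightarrow> real^3) \<Rightarrow> bool" where
  "test_field \<phi> \<longleftrightarrow> (\<forall>i. smooth (\<lambda>x. \<phi> x $ i)) \<and> compact (closure {x. \<phi> x \<noteq> 0})"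

definition divergence :: "(real^3 \<Rightarrow> real^3) \<Rightarrow> real^3 \<Rightarrow> real" where
  "divergence \<phi> x = (\<Sum>i\<in>UNIV. partial i (\<lambda>y. \<phi> y $ i) x)"

definition L2_loc :: "(real^3 \<Rightarrow> real^3) \<Rightarrow> bool" where
  "L2_loc u \<longleftrightarrow> u \<in> borel_measurable lebesgue \<and>
     (\<forall>K. compact K \<longrightarrow> set_integrable lebesgue K (\<lambda>x. (norm (u x))\<^sup>2))"

definition weak_euler :: "(real^3 \<Rightarrow> real^3) \<Rightarrow> (real^3 \<Rightarrow> real) \<Rightarrow> bool" where
  "weak_euler u p \<longleftrightarrow> (\<forall>\<phi>. test_field \<phi> \<longrightarrow>
     (\<integral>x. (\<Sum>i\<in>UNIV. \<Sum>j\<in>UNIV. u x $ i * u x $ j * partial j (\<lambda>y. \<phi> y $ i) x) \<partial>lebesgue)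
       = - (\<integral>x. p x * divergence \<phi> x \<partial>lebesgue))"

definition normal_part :: "(real^3 \<Rightarrow> real^3) \<Rightarrow> real^3 \<Rightarrow> real^3" where
  "normal_part u x = (u x \<bullet> (x /\<^sub>R norm x)) *\<^sub>R (x /\<^sub>R norm x)"

definition tangential_part :: "(real^3 \<Rightarrow> real^3) \<Rightarrow> real^3 \<Rightarrow> real^3" where
  "tangential_part u x = cross3 (u x) (x /\<^sub>R norm x)"

text \<open>Cone construction: for A on the sphere of radius R,
  S_R(A) = (3/R) * Lebesgue measure of {x in B_R - {0} : R x/|x| in A}.\<close>
definition sphere_measure :: "real \<Rightarrow> (real^3) measure" where
  "sphere_measure R = scale_measure (ennreal (3 / R))
     (distr (restrict_space lebesgue (ball 0 R - {0})) borel (\<lambda>x. (R / norm x) *\<^sub>R x))"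

end

theory Submission
  imports Defs
begin

text \<open>
  Write \<open>M(r)\<close> for the energy of \<open>u\<close> in the ball of radius \<open>r\<close>, and \<open>N(r)\<close>, \<open>T(r)\<close> for the integrals
  of the squared normal and tangential parts over the sphere of radius \<open>r\<close>. Testing the equation
  with smooth approximations of the radial field \<open>max (\<rho>\<^sup>2 - |x|\<^sup>2) 0 \<cdot> x\<close> and letting \<open>\<rho>\<close> vary gives
  \<open>T(r) = N(r) + M(r) / r\<close> for almost every \<open>r\<close>, by polar coordinates. Since \<open>M' = N + T\<close>, dividing
  by \<open>r\<close> and integrating yields
  \<open>M(R) / R - M(\<epsilon>) / \<epsilon> = 2 \<integral> |u\<^sub>N|\<^sup>2 / |x|\<close> over \<open>\<epsilon> < |x| < R\<close>. The first claim follows as \<open>\<epsilon>\<close>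
  tends to 0. Moreover \<open>M(r) / r\<close> is nondecreasing and bounded by \<open>T(r)\<close> for almost every \<open>r\<close>, so it
  vanishes as soon as \<open>T\<close> tends to 0 along some sequence of radii.
\<close>

subsection \<open>Smooth radial test fields\<close>

text \<open>With \<open>s = 1 / t\<close>, the derivative in \<open>t\<close> of
  \<open>t * p(s) * exp (- s)\<close> is
  \<open>t * ((s + s^2) * p(s) - s^2 * p'(s)) * exp (- s)\<close>; the recursion is this passage
  from one derivative to the next.\<close>

fun flat_poly :: "nat \<Rightarrow> real poly" where
  "flat_poly 0 = 1"
| "flat_poly (Suc k) = [:0, 1, 1:] * flat_poly k - [:0, 0, 1:] * pderiv (flat_poly k)"

text \<open>\<open>flat k\<close> is the \<open>k\<close>-th derivative of the function equal to \<open>t exp (- 1 / t)\<close> for \<open>t > 0\<close> and to 0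
  for \<open>t \<le> 0\<close>; its first derivative \<open>(1 + 1 / t) exp (- 1 / t)\<close> takes values in \<open>[0, 1]\<close>.\<close>

definition flat :: "nat \<Rightarrow> real \<Rightarrow> real" where
  "flat k t = (if t > 0 then t * poly (flat_poly k) (1 / t) * exp (- (1 / t)) else 0)"

lemma tendsto_poly_mult_exp_minus:
  fixes p :: "real poly"
  shows "((\<lambda>y. poly p y * exp (- y)) \<longlongrightarrow> 0) at_top"
proof -
  have "((\<lambda>y. \<Sum>i\<le>degree p. coeff p i * (y ^ i / exp y)) \<longlongrightarrow> (\<Sum>i\<le>degree p. coeff p i * 0)) at_top"
    by (intro tendsto_sum tendsto_mult tendsto_const tendsto_power_div_exp_0)
  moreover have "(\<lambda>y. poly p y * exp (- y)) = (\<lambda>y. \<Sum>i\<le>degree p. coeff p i * (y ^ i / exp y))"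
    by (auto simp: poly_altdef sum_distrib_right exp_minus divide_inverse mult.assoc)
  ultimately show ?thesis by simp
qed

lemma flat_has_derivative: "(flat k has_real_derivative flat (Suc k) t) (at t)"
proof -
  consider "t > 0" | "t < 0" | "t = 0" by linarith
  then show ?thesis
  proof cases
    case 1
    let ?f = "\<lambda>t. t * poly (flat_poly k) (1 / t) * exp (- (1 / t))"
    have "(?f has_real_derivative flat (Suc k) t) (at t)"
      unfolding flat_def using 1
      by (auto intro!: derivative_eq_intros simp: field_simps power2_eq_square)
    moreover have "?f x = flat k x" if "x \<in> {0<..}" for x
      using that by (simp add: flat_def)
    ultimately show ?thesis
      using 1 by (intro has_field_derivative_transform_within_open[of ?f _ t "{0<..}" "flat k"]) auto
  next
    case 2
    have "((\<lambda>_. 0) has_real_derivative flat (Suc k) t) (at t)"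
      using 2 by (simp add: flat_def)
    then show ?thesis
      using 2 by (intro has_field_derivative_transform_within_open[of "\<lambda>_. 0" _ t "{..<0}" "flat k"])
        (auto simp: flat_def)
  next
    case 3
    \<comment> \<open>For \<open>h > 0\<close> the factor \<open>t\<close> in \<open>flat\<close>
      cancels, so the difference quotient at 0 is a polynomial in \<open>1 / h\<close> times
      \<open>exp (- 1 / h)\<close>. On the left of 0 it vanishes.\<close>
    have "((\<lambda>h. poly (flat_poly k) (inverse h) * exp (- inverse h)) \<longlongrightarrow> 0) (at_right (0::real))"
      by (rule filterlim_compose[OF tendsto_poly_mult_exp_minus filterlim_inverse_at_top_right])
    then have r: "((\<lambda>h. flat k h / h) \<longlongrightarrow> 0) (at_right 0)"
      by (rule Lim_transform_eventually)
        (auto simp: flat_def eventually_at_filter field_simps intro!: always_eventually)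
    have l: "((\<lambda>h. flat k h / h) \<longlongrightarrow> 0) (at_left 0)"
      by (rule Lim_transform_eventually[OF tendsto_const])
        (auto simp: flat_def eventually_at_filter intro!: always_eventually)
    show ?thesis
      using filterlim_split_at[OF l r] 3 by (simp add: DERIV_def flat_def)
  qed
qed

text \<open>An algebra of differentiable functions that contains the components of the test fields
  and is closed under all partial derivatives: differentiating a generator \<open>flat k\<close>
  only raises \<open>k\<close> and produces a polynomial factor. Closure yields derivatives of every
  order at once, with no explicit formula for them.\<close>

inductive_set flat_algebra :: "real \<Rightarrow> real \<Rightarrow> (real^3 \<Rightarrow> real) set" for m b where
  const: "(\<lambda>x. c) \<in> flat_algebra m b"
| coord: "(\<lambda>x. x $ i) \<in> flat_algebra m b"
| flat: "(\<lambda>x. flat k (m * (b - x \<bullet> x))) \<in> flat_algebra m b"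
| add: "f \<in> flat_algebra m b \<Longrightarrow> g \<in> flat_algebra m b \<Longrightarrow> (\<lambda>x. f x + g x) \<in> flat_algebra m b"
| mult: "f \<in> flat_algebra m b \<Longrightarrow> g \<in> flat_algebra m b \<Longrightarrow> (\<lambda>x. f x * g x) \<in> flat_algebra m b"

lemma partial_eq: "(f has_derivative f') (at x) \<Longrightarrow> partial j f x = f' (axis j 1)"
  unfolding partial_def using frechet_derivative_at by metis

lemma has_derivative_flat_radial:
  fixes x :: "'a::real_inner"
  shows "((\<lambda>x. flat k (m * (b - x \<bullet> x))) has_derivative
    (\<lambda>h. flat (Suc k) (m * (b - x \<bullet> x)) * (- 2 * m * (x \<bullet> h)))) (at x)"
proof -
  have "((\<lambda>x. m * (b - x \<bullet> x)) has_derivative (\<lambda>h. - 2 * m * (x \<bullet> h))) (at x)"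
    by (auto intro!: derivative_eq_intros simp: inner_commute algebra_simps)
  from has_derivative_compose[OF this flat_has_derivative[unfolded has_field_derivative_def]]
  show ?thesis by (simp add: mult.commute)
qed

lemma flat_algebra_partial:
  assumes "f \<in> flat_algebra m b"
  shows "(\<forall>x. f differentiable (at x)) \<and> (\<forall>j. partial j f \<in> flat_algebra m b)"
  using assms
proof induction
  case (const c)
  have "partial j (\<lambda>x. c) = (\<lambda>x. 0)" for j
    by (rule ext, subst partial_eq[OF has_derivative_const]) simp
  then show ?case by (auto intro: flat_algebra.const)
next
  case (coord i)
  have d: "((\<lambda>x::real^3. x $ i) has_derivative (\<lambda>h. h $ i)) (at x)" for x
    by (rule bounded_linear_imp_has_derivative[OF bounded_linear_vec_nth])
  have "partial j (\<lambda>x. x $ i) = (\<lambda>x. axis j 1 $ i)" for j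
    by (rule ext, subst partial_eq[OF d]) simp
  then show ?case using d by (auto intro: flat_algebra.const simp: differentiable_def)
next
  case (flat k)
  have "partial j (\<lambda>x. flat k (m * (b - x \<bullet> x))) =
      (\<lambda>x. flat (Suc k) (m * (b - x \<bullet> x)) * ((- 2 * m) * x $ j))" for j
    by (rule ext, subst partial_eq[OF has_derivative_flat_radial]) (simp add: inner_axis)
  moreover have "(\<lambda>x. flat (Suc k) (m * (b - x \<bullet> x)) * ((- 2 * m) * x $ j)) \<in> flat_algebra m b" for j
    by (intro flat_algebra.intros)
  moreover have "(\<lambda>x. flat k (m * (b - x \<bullet> x))) differentiable (at x)" for x :: "real^3"
    by (rule differentiableI[OF has_derivative_flat_radial])
  ultimately show ?case by simp
next
  case (add f g)
  have "partial j (\<lambda>x. f x + g x) = (\<lambda>x. partial j f x + partial j g x)" for j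
  proof (rule ext)
    fix x
    have "((\<lambda>x. f x + g x) has_derivative
        (\<lambda>h. frechet_derivative f (at x) h + frechet_derivative g (at x) h)) (at x)"
      using add.IH by (intro has_derivative_add) (auto simp: frechet_derivative_works)
    from partial_eq[OF this] show "partial j (\<lambda>x. f x + g x) x = partial j f x + partial j g x"
      by (simp add: partial_def)
  qed
  then show ?case using add.IH by (auto intro: flat_algebra.add)
next
  case (mult f g)
  have "partial j (\<lambda>x. f x * g x) = (\<lambda>x. f x * partial j g x + partial j f x * g x)" for j
  proof (rule ext)
    fix x
    have "((\<lambda>x. f x * g x) has_derivative
        (\<lambda>h. f x * frechet_derivative g (at x) h + frechet_derivative f (at x) h * g x)) (at x)"
      using mult.IH by (intro has_derivative_mult) (auto simp: frechet_derivative_works)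
    from partial_eq[OF this]
    show "partial j (\<lambda>x. f x * g x) x = f x * partial j g x + partial j f x * g x"
      by (simp add: partial_def)
  qed
  then show ?case using mult.IH mult.hyps by (auto intro!: flat_algebra.add flat_algebra.mult)
qed

lemma flat_algebra_smooth:
  assumes "f \<in> flat_algebra m b"
  shows "smooth f"
proof -
  have "iter_partial js f \<in> flat_algebra m b" for js
    using assms by (induction js) (auto simp: flat_algebra_partial)
  then show ?thesis unfolding smooth_def using flat_algebra_partial by blast
qed

section \<open>Bounds and scaling limits of the cutoff profiles\<close>

lemma flat_eq_0: "t \<le> 0 \<Longrightarrow> flat k t = 0"
  by (simp add: flat_def)

lemma flat_0_bounds: "0 \<le> flat 0 t" "t \<ge> 0 \<Longrightarrow> flat 0 t \<le> t"
  by (auto simp: flat_def mult_le_cancel_left1)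

lemma flat_1: "flat (Suc 0) t = (if t > 0 then (1 + 1 / t) * exp (- (1 / t)) else 0)"
  by (simp add: flat_def field_simps)

text \<open>The upper bound is \<open>1 + s <= exp s\<close> at \<open>s = 1 / t\<close>. It is
  uniform in the argument, so the derivative terms of the test fields stay dominated when the
  profile is rescaled.\<close>

lemma flat_1_bounds: "0 \<le> flat (Suc 0) t" "flat (Suc 0) t \<le> 1"
proof -
  show "flat (Suc 0) t \<le> 1"
  proof (cases "t > 0")
    case True
    have "1 + 1 / t \<le> exp (1 / t)" by (rule exp_ge_add_one_self)
    then show ?thesis using True by (simp add: flat_1 exp_minus field_simps)
  qed (simp add: flat_1)
qed (simp add: flat_1)

lemma tendsto_inverse_Suc_mult:
  assumes "c > 0"
  shows "(\<lambda>n. 1 / (real (Suc n) * c)) \<longlonglongrightarrow> 0"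
proof -
  have "(\<lambda>n. inverse (real (Suc n)) * (1 / c)) \<longlonglongrightarrow> 0 * (1 / c)"
    by (intro tendsto_mult tendsto_const LIMSEQ_inverse_real_of_nat)
  then show ?thesis by (simp add: field_simps)
qed

text \<open>For \<open>c > 0\<close> the rescaled profile at stage \<open>n\<close> equals
  \<open>c * exp (- 1 / ((n + 1) * c))\<close>. It thus approximates the positive part by smooth
  functions, while the derivatives tend to the indicator of the positive half-line
  (\<open>flat_1_limit\<close>).\<close>

lemma flat_limit: "(\<lambda>n. flat 0 (real (Suc n) * c) / real (Suc n)) \<longlonglongrightarrow> max c 0"
proof (cases "c > 0")
  case True
  have "(\<lambda>n. c * exp (- (1 / (real (Suc n) * c)))) \<longlonglongrightarrow> c * exp (- 0)"
    by (intro tendsto_intros tendsto_inverse_Suc_mult True)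
  moreover have "flat 0 (real (Suc n) * c) / real (Suc n) = c * exp (- (1 / (real (Suc n) * c)))" for n
    using True by (simp add: flat_def del: of_nat_Suc)
  ultimately show ?thesis using True by (simp del: of_nat_Suc)
next
  case False
  then have "flat 0 (real (Suc n) * c) = 0" for n
    by (intro flat_eq_0) (simp add: mult_le_0_iff)
  then show ?thesis using False by (simp add: max_def)
qed

lemma flat_1_limit: "(\<lambda>n. flat (Suc 0) (real (Suc n) * c)) \<longlonglongrightarrow> indicator {0<..} c"
proof (cases "c > 0")
  case True
  have "(\<lambda>n. (1 + 1 / (real (Suc n) * c)) * exp (- (1 / (real (Suc n) * c)))) \<longlonglongrightarrow> (1 + 0) * exp (- 0)"
    by (intro tendsto_intros tendsto_inverse_Suc_mult True)
  then show ?thesis using True by (simp add: flat_1 del: of_nat_Suc)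
next
  case False
  then have "flat (Suc 0) (real (Suc n) * c) = 0" for n
    by (intro flat_eq_0) (simp add: mult_le_0_iff)
  then show ?thesis using False by simp
qed

subsection \<open>Polar coordinates for the cone measure\<close>

lemma nn_integral_lborel_cong_except:
  fixes f g :: "'a::euclidean_space \<Rightarrow> ennreal"
  assumes "\<And>x. x \<noteq> c \<Longrightarrow> f x = g x"
  shows "(\<integral>\<^sup>+x. f x \<partial>lborel) = (\<integral>\<^sup>+x. g x \<partial>lborel)"
  using assms AE_lborel_singleton[of c] by (intro nn_integral_cong_AE) (auto elim: eventually_mono)

lemma nn_integral_lborel_scaleR:
  fixes f :: "'a::euclidean_space \<Rightarrow> ennreal"
  assumes [measurable]: "f \<in> borel_measurable borel" and c: "c > 0"
  shows "(\<integral>\<^sup>+x. f x \<partial>lborel) = ennreal (c ^ DIM('a)) * (\<integral>\<^sup>+x. f (c *\<^sub>R x) \<partial>lborel)"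
  by (subst lborel_affine[of c 0])
    (use c in \<open>auto simp: nn_integral_density nn_integral_distr nn_integral_cmult abs_of_pos\<close>)

text \<open>The substitution \<open>x = r z\<close> moves the cone over the sphere into the unit
  ball, with total factor \<open>(3 / r) * r^3 = 3 r^2\<close>. The domain of integration then no
  longer depends on \<open>r\<close>, which gives measurability in \<open>r\<close> and opens the
  way to Tonelli.\<close>

lemma nn_integral_sphere_measure_cone:
  fixes g :: "real^3 \<Rightarrow> ennreal"
  assumes [measurable]: "g \<in> borel_measurable borel" and r: "r > 0"
  shows "(\<integral>\<^sup>+x. g x \<partial>sphere_measure r) =
    ennreal (3 * r\<^sup>2) * (\<integral>\<^sup>+z. g ((r / norm z) *\<^sub>R z) * indicator {..<1} (norm z) \<partial>lborel)"
proof -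
  let ?h = "\<lambda>x::real^3. (r / norm x) *\<^sub>R x"
  have h[measurable]: "?h \<in> borel_measurable borel" by measurable
  have h': "?h \<in> borel_measurable (restrict_space lebesgue (ball 0 r - {0}))"
    by (intro measurable_restrict_space1 measurable_completion) simp
  have "(\<integral>\<^sup>+x. g x \<partial>sphere_measure r) =
      ennreal (3 / r) * (\<integral>\<^sup>+x. g (?h x) \<partial>restrict_space lebesgue (ball 0 r - {0}))"
    unfolding sphere_measure_def using h'
    by (simp add: nn_integral_scale_measure nn_integral_distr)
  also have "(\<integral>\<^sup>+x. g (?h x) \<partial>restrict_space lebesgue (ball 0 r - {0})) =
      (\<integral>\<^sup>+x. g (?h x) * indicator (ball 0 r - {0}) x \<partial>lborel)"
    by (subst nn_integral_restrict_space) (auto simp: nn_integral_completion)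
  also have "\<dots> = (\<integral>\<^sup>+x. g (?h x) * indicator {..<r} (norm x) \<partial>lborel)"
    by (intro nn_integral_lborel_cong_except[of 0]) (auto split: split_indicator)
  also have "\<dots> = ennreal (r ^ 3) * (\<integral>\<^sup>+z. g (?h (r *\<^sub>R z)) * indicator {..<r} (norm (r *\<^sub>R z)) \<partial>lborel)"
    by (subst nn_integral_lborel_scaleR[OF _ r]) auto
  also have "(\<lambda>z. g (?h (r *\<^sub>R z)) * indicator {..<r} (norm (r *\<^sub>R z))) =
      (\<lambda>z. g (?h z) * indicator {..<1} (norm z))"
    using r by (auto simp: fun_eq_iff indicator_def)
  finally show ?thesis
    using r by (simp add: mult.assoc[symmetric] ennreal_mult'[symmetric] power2_eq_square power3_eq_cube)
qed

lemma borel_measurable_nn_integral_sphere_measure: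
  fixes g :: "real^3 \<Rightarrow> ennreal"
  assumes [measurable]: "g \<in> borel_measurable borel"
  shows "(\<lambda>r. (\<integral>\<^sup>+x. g x \<partial>sphere_measure r) * indicator {0<..} r) \<in> borel_measurable borel"
proof -
  have "(\<lambda>r. ennreal (3 * r\<^sup>2) * (\<integral>\<^sup>+z. g ((r / norm z) *\<^sub>R z) * indicator {..<1} (norm z) \<partial>lborel)
     * indicator {0<..} r) \<in> borel_measurable borel"
    by measurable
  moreover have "(\<lambda>r. (\<integral>\<^sup>+x. g x \<partial>sphere_measure r) * indicator {0<..} r) =
    (\<lambda>r. ennreal (3 * r\<^sup>2) * (\<integral>\<^sup>+z. g ((r / norm z) *\<^sub>R z) * indicator {..<1} (norm z) \<partial>lborel)
     * indicator {0<..} r)"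
    by (auto simp: fun_eq_iff nn_integral_sphere_measure_cone split: split_indicator)
  ultimately show ?thesis by simp
qed

lemma nn_integral_quartic_tail:
  fixes a :: real
  assumes "a > 0"
  shows "(\<integral>\<^sup>+t. ennreal (1 / t ^ 4) * indicator {a<..} t \<partial>lborel) = ennreal (1 / (3 * a ^ 3))"
proof -
  have "(\<integral>\<^sup>+t. ennreal (1 / t ^ 4) * indicator {a<..} t \<partial>lborel) =
      (\<integral>\<^sup>+t. ennreal (1 / t ^ 4) * indicator {a..} t \<partial>lborel)"
    by (intro nn_integral_lborel_cong_except[of a]) (auto split: split_indicator)
  also have "\<dots> = ennreal (0 - (- (1 / (3 * a ^ 3))))"
  proof (rule nn_integral_FTC_atLeast)
    show "((\<lambda>t. - (1 / (3 * t ^ 3))) has_real_derivative 1 / x ^ 4) (at x)" if "a \<le> x" for x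
      using that assms by (auto intro!: derivative_eq_intros simp: field_simps power_numeral_reduce)
    have "((\<lambda>t::real. - (inverse t ^ 3 / 3)) \<longlongrightarrow> - (0 ^ 3 / 3)) at_top"
      by (intro tendsto_intros tendsto_inverse_0_at_top filterlim_ident) auto
    then show "((\<lambda>t::real. - (1 / (3 * t ^ 3))) \<longlongrightarrow> 0) at_top"
      by (simp add: field_simps)
  qed (use assms in auto)
  finally show ?thesis by simp
qed

text \<open>Integrating the cone formula over the radius and substituting \<open>r = |z| t\<close> and then
  \<open>w = t z\<close> leaves the inner integral of \<open>3 |w|\<^sup>3 / t\<^sup>4\<close> over \<open>t > |w|\<close>, which is 1.\<close>

lemma nn_integral_polar:
  fixes g :: "real^3 \<Rightarrow> ennreal"
  assumes [measurable]: "g \<in> borel_measurable borel"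
  shows "(\<integral>\<^sup>+x. g x \<partial>lborel) =
    (\<integral>\<^sup>+r. (\<integral>\<^sup>+x. g x \<partial>sphere_measure r) * indicator {0<..} r \<partial>lborel)"
proof -
  let ?A = "\<lambda>r (z::real^3). ennreal (3 * r\<^sup>2) * g ((r / norm z) *\<^sub>R z) * indicator {..<1} (norm z) * indicator {0<..} r"
  let ?B = "\<lambda>t (z::real^3). ennreal (3 * t\<^sup>2 * norm z ^ 3) * g (t *\<^sub>R z) * indicator {..<1} (norm z) * indicator {0<..} t"
  let ?C = "\<lambda>t (w::real^3). ennreal (3 * norm w ^ 3 / t ^ 4) * g w * indicator {0<..} (t - norm w)"
  have "(\<integral>\<^sup>+r. (\<integral>\<^sup>+x. g x \<partial>sphere_measure r) * indicator {0<..} r \<partial>lborel) =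
      (\<integral>\<^sup>+r. (\<integral>\<^sup>+z. ?A r z \<partial>lborel) \<partial>lborel)"
    by (intro nn_integral_cong)
      (auto simp: nn_integral_sphere_measure_cone nn_integral_cmult[symmetric] mult.assoc split: split_indicator)
  also have "\<dots> = (\<integral>\<^sup>+z. (\<integral>\<^sup>+r. ?A r z \<partial>lborel) \<partial>lborel)"
    by (rule lborel_pair.Fubini'[symmetric]) measurable
  also have "\<dots> = (\<integral>\<^sup>+z. (\<integral>\<^sup>+t. ?B t z \<partial>lborel) \<partial>lborel)"
  proof (rule nn_integral_lborel_cong_except[of 0])
    fix z :: "real^3" assume z: "z \<noteq> 0"
    have "(\<integral>\<^sup>+r. ?A r z \<partial>lborel) = ennreal (norm z) * (\<integral>\<^sup>+t. ?A (0 + norm z * t) z \<partial>lborel)"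
      using z by (subst nn_integral_real_affine[of _ "norm z" 0]) auto
    also have "\<dots> = (\<integral>\<^sup>+t. ennreal (norm z) * ?A (0 + norm z * t) z \<partial>lborel)"
      by (rule nn_integral_cmult[symmetric]) measurable
    also have "\<dots> = (\<integral>\<^sup>+t. ?B t z \<partial>lborel)"
    proof (rule nn_integral_cong)
      fix t :: real
      have "ennreal (norm z) * ennreal (3 * (norm z * t)\<^sup>2) = ennreal (3 * t\<^sup>2 * norm z ^ 3)"
        by (subst ennreal_mult'[symmetric]) (auto simp: power2_eq_square power3_eq_cube mult_ac)
      then show "ennreal (norm z) * ?A (0 + norm z * t) z = ?B t z"
        using z by (auto split: split_indicator simp: zero_less_mult_iff mult.assoc[symmetric])
    qed
    finally show "(\<integral>\<^sup>+r. ?A r z \<partial>lborel) = (\<integral>\<^sup>+t. ?B t z \<partial>lborel)" .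
  qed
  also have "\<dots> = (\<integral>\<^sup>+t. (\<integral>\<^sup>+z. ?B t z \<partial>lborel) \<partial>lborel)"
    by (rule lborel_pair.Fubini') measurable
  also have "\<dots> = (\<integral>\<^sup>+t. (\<integral>\<^sup>+w. ?C t w \<partial>lborel) \<partial>lborel)"
  proof (rule nn_integral_cong)
    fix t :: real
    show "(\<integral>\<^sup>+z. ?B t z \<partial>lborel) = (\<integral>\<^sup>+w. ?C t w \<partial>lborel)"
    proof (cases "t > 0")
      case True
      have "(\<lambda>w. ?C t w) \<in> borel_measurable borel" by measurable
      from nn_integral_lborel_scaleR[OF this True]
      have "(\<integral>\<^sup>+w. ?C t w \<partial>lborel) = ennreal (t ^ 3) * (\<integral>\<^sup>+z. ?C t (t *\<^sub>R z) \<partial>lborel)"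
        by simp
      also have "\<dots> = (\<integral>\<^sup>+z. ennreal (t ^ 3) * ?C t (t *\<^sub>R z) \<partial>lborel)"
        by (rule nn_integral_cmult[symmetric]) measurable
      also have "\<dots> = (\<integral>\<^sup>+z. ?B t z \<partial>lborel)"
      proof (rule nn_integral_cong)
        fix z :: "real^3"
        have "ennreal (t ^ 3) * ennreal (3 * norm (t *\<^sub>R z) ^ 3 / t ^ 4) = ennreal (3 * t\<^sup>2 * norm z ^ 3)"
          using True by (subst ennreal_mult'[symmetric])
            (auto simp: power_mult_distrib field_simps simp flip: power_add)
        then show "ennreal (t ^ 3) * ?C t (t *\<^sub>R z) = ?B t z"
          using True by (auto split: split_indicator simp: mult.assoc[symmetric])
      qed
      finally show ?thesis by simp
    next
      case False
      have "\<not> norm w < t" for w :: "real^3"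
        using False norm_ge_zero[of w] by linarith
      then show ?thesis using False by simp
    qed
  qed
  also have "\<dots> = (\<integral>\<^sup>+w. (\<integral>\<^sup>+t. ?C t w \<partial>lborel) \<partial>lborel)"
    by (rule lborel_pair.Fubini'[symmetric]) measurable
  also have "\<dots> = (\<integral>\<^sup>+w. g w \<partial>lborel)"
  proof (rule nn_integral_lborel_cong_except[of 0])
    fix w :: "real^3" assume w: "w \<noteq> 0"
    have "(\<integral>\<^sup>+t. ?C t w \<partial>lborel) =
      (\<integral>\<^sup>+t. (ennreal (3 * norm w ^ 3) * g w) * (ennreal (1 / t ^ 4) * indicator {norm w<..} t) \<partial>lborel)"
    proof (rule nn_integral_cong)
      fix t :: real
      have "ennreal (3 * norm w ^ 3 / t ^ 4) = ennreal (3 * norm w ^ 3) * ennreal (1 / t ^ 4)"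
        by (subst ennreal_mult'[symmetric]) auto
      then show "?C t w = ennreal (3 * norm w ^ 3) * g w * (ennreal (1 / t ^ 4) * indicator {norm w<..} t)"
        by (simp add: mult_ac split: split_indicator)
    qed
    also have "\<dots> = ennreal (3 * norm w ^ 3) * g w * ennreal (1 / (3 * norm w ^ 3))"
      using w by (subst nn_integral_cmult) (auto simp: nn_integral_quartic_tail)
    also have "\<dots> = g w * ennreal (3 * norm w ^ 3 * (1 / (3 * norm w ^ 3)))"
      by (subst ennreal_mult') (auto simp: mult_ac)
    also have "\<dots> = g w" using w by simp
    finally show "(\<integral>\<^sup>+t. ?C t w \<partial>lborel) = g w" .
  qed
  finally show ?thesis by simp
qed

lemma nn_integral_sphere_measure_radial:
  fixes g :: "real^3 \<Rightarrow> ennreal"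
  assumes [measurable]: "g \<in> borel_measurable borel" "w \<in> borel_measurable borel" and r: "r > 0"
  shows "(\<integral>\<^sup>+x. w (norm x) * g x \<partial>sphere_measure r) = w r * (\<integral>\<^sup>+x. g x \<partial>sphere_measure r)"
proof -
  \<comment> \<open>The projected point has norm \<open>r\<close> except at \<open>z = 0\<close>,
    where division by zero sends it to the origin; a single point is negligible.\<close>
  have "(\<integral>\<^sup>+z. w (norm ((r / norm z) *\<^sub>R (z::real^3))) * g ((r / norm z) *\<^sub>R z) * indicator {..<1} (norm z) \<partial>lborel) =
    (\<integral>\<^sup>+z. w r * (g ((r / norm z) *\<^sub>R (z::real^3)) * indicator {..<1} (norm z)) \<partial>lborel)"
    using r by (intro nn_integral_lborel_cong_except[of 0])
      (auto split: split_indicator)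
  then show ?thesis
    by (simp add: nn_integral_sphere_measure_cone[OF _ r] nn_integral_cmult mult_ac)
qed

subsection \<open>Testing the equation with radial fields\<close>

lemma partial_flat_field:
  "partial j (\<lambda>y. (flat 0 (m * (b - y \<bullet> y)) *\<^sub>R y) $ i) x =
     flat 0 (m * (b - x \<bullet> x)) * (if i = j then 1 else 0)
     - 2 * m * flat (Suc 0) (m * (b - x \<bullet> x)) * x $ j * x $ i"
proof -
  have "((\<lambda>y. flat 0 (m * (b - y \<bullet> y)) * y $ i) has_derivative
     (\<lambda>h. flat 0 (m * (b - x \<bullet> x)) * h $ i
        + flat (Suc 0) (m * (b - x \<bullet> x)) * (- 2 * m * (x \<bullet> h)) * x $ i)) (at x)"
    by (intro has_derivative_mult has_derivative_flat_radial
      bounded_linear_imp_has_derivative[OF bounded_linear_vec_nth])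
  from partial_eq[OF this] show ?thesis
    by (auto simp: inner_axis axis_eq_axis) (auto simp: axis_def)
qed

lemma test_field_flat_field:
  assumes "m > 0"
  shows "test_field (\<lambda>x. flat 0 (m * (b - x \<bullet> x)) *\<^sub>R x)"
  unfolding test_field_def
proof (intro conjI allI)
  fix i :: 3
  have "(\<lambda>x. flat 0 (m * (b - x \<bullet> x)) * x $ i) \<in> flat_algebra m b"
    by (intro flat_algebra.intros)
  then show "smooth (\<lambda>x. (flat 0 (m * (b - x \<bullet> x)) *\<^sub>R x) $ i)"
    using flat_algebra_smooth by simp
next
  have "norm x \<le> sqrt b" if "flat 0 (m * (b - x \<bullet> x)) \<noteq> 0" for x :: "real^3"
  proof -
    have "0 < m * (b - x \<bullet> x)"
      using that flat_eq_0 not_le by blast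
    then have "x \<bullet> x \<le> b" using assms by (simp add: zero_less_mult_iff)
    then show ?thesis by (simp add: norm_eq_sqrt_inner)
  qed
  then have "{x::real^3. flat 0 (m * (b - x \<bullet> x)) *\<^sub>R x \<noteq> 0} \<subseteq> cball 0 (sqrt b)"
    by auto
  then have "bounded {x::real^3. flat 0 (m * (b - x \<bullet> x)) *\<^sub>R x \<noteq> 0}"
    using bounded_cball bounded_subset by blast
  then show "compact (closure {x::real^3. flat 0 (m * (b - x \<bullet> x)) *\<^sub>R x \<noteq> 0})"
    by simp
qed

lemma L2_loc_integrable_bound:
  fixes f :: "real^3 \<Rightarrow> real"
  assumes "L2_loc u" "f \<in> borel_measurable lebesgue"
    and "\<And>x. \<bar>f x\<bar> \<le> c * (indicator (cball 0 r) x * (norm (u x))\<^sup>2)"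
  shows "integrable lebesgue f"
proof (rule Bochner_Integration.integrable_bound)
  show "integrable lebesgue (\<lambda>x. c * (indicator (cball 0 r) x * (norm (u x))\<^sup>2))"
    using assms(1) by (auto simp: L2_loc_def set_integrable_def)
qed (use assms(2,3) order_trans[OF _ abs_ge_self] in auto)

lemma borel_measurable_flat [measurable]: "flat k \<in> borel_measurable borel"
  by (intro borel_measurable_continuous_onI continuous_at_imp_continuous_on ballI
      DERIV_isCont[OF flat_has_derivative])

lemma inner_square_le:
  fixes x y :: "'a::real_inner"
  shows "(x \<bullet> y)\<^sup>2 \<le> (norm x)\<^sup>2 * (y \<bullet> y)"
  using Cauchy_Schwarz_ineq[of x y] by (simp add: power2_norm_eq_inner)

text \<open>Write \<open>P\<close> and \<open>Q\<close> for \<open>flat 0\<close> and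
  \<open>flat (Suc 0)\<close> at \<open>m * (b - |x|^2)\<close>. The field \<open>P x\<close> turns
  the left integrand into \<open>P |u|^2 - 2 m Q (u . x)^2\<close> and has divergence
  \<open>3 P - 2 m Q |x|^2\<close>. Collecting terms with \<open>p = - |u|^2 / 2\<close> leaves
  \<open>- m\<close> times \<open>\<Phi>\<close>. Dividing by \<open>m\<close> makes the pointwise
  bound independent of \<open>m\<close>, as needed for \<open>m\<close> tending to infinity.\<close>

lemma weak_euler_flat_field:
  fixes u :: "real^3 \<Rightarrow> real^3"
  assumes u: "L2_loc u" and weak: "weak_euler u (\<lambda>x. - ((norm (u x))\<^sup>2 / 2))"
    and m: "m > 0" and b: "b > 0"
  defines "\<Phi> \<equiv> (\<lambda>x. flat 0 (m * (b - x \<bullet> x)) / m * (norm (u x))\<^sup>2 / 2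
      + flat (Suc 0) (m * (b - x \<bullet> x)) * (2 * (u x \<bullet> x)\<^sup>2 - (x \<bullet> x) * (norm (u x))\<^sup>2))"
  shows "\<Phi> \<in> borel_measurable lebesgue"
    and "\<bar>\<Phi> x\<bar> \<le> 4 * b * (indicator (cball 0 (sqrt b)) x * (norm (u x))\<^sup>2)"
    and "(\<integral>x. \<Phi> x \<partial>lebesgue) = 0"
proof -
  let ?P = "\<lambda>x::real^3. flat 0 (m * (b - x \<bullet> x))" and ?Q = "\<lambda>x::real^3. flat (Suc 0) (m * (b - x \<bullet> x))"
  have um[measurable]: "u \<in> borel_measurable lebesgue" using u by (simp add: L2_loc_def)
  have id[measurable]: "(\<lambda>x::real^3. x) \<in> borel_measurable lebesgue"
    by (intro measurable_completion) simp
  show meas: "\<Phi> \<in> borel_measurable lebesgue" unfolding \<Phi>_def by measurable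
  have supp: "?P x = 0" "?Q x = 0" if "x \<notin> cball 0 (sqrt b)" for x
  proof -
    have "b \<le> x \<bullet> x" using that b by (auto simp: norm_eq_sqrt_inner)
    then have "m * (b - x \<bullet> x) \<le> 0" using m by (simp add: mult_le_0_iff)
    then show "?P x = 0" "?Q x = 0" by (simp_all add: flat_eq_0)
  qed
  have P: "0 \<le> ?P x" "?P x \<le> m * b" for x
  proof -
    show "0 \<le> ?P x" by (rule flat_0_bounds)
    show "?P x \<le> m * b"
    proof (cases "b - x \<bullet> x \<ge> 0")
      case True
      then have "?P x \<le> m * (b - x \<bullet> x)" using m by (intro flat_0_bounds) simp
      also have "\<dots> \<le> m * b" using m by simp
      finally show ?thesis .
    next
      case False
      then show ?thesis using m b by (subst flat_eq_0) (auto simp: mult_le_0_iff)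
    qed
  qed
  note Q = flat_1_bounds
  have bd: "(u x \<bullet> x)\<^sup>2 \<le> b * (norm (u x))\<^sup>2" "(x \<bullet> x) * (norm (u x))\<^sup>2 \<le> b * (norm (u x))\<^sup>2"
    if "x \<in> cball 0 (sqrt b)" for x
  proof -
    have "x \<bullet> x \<le> b" using that b by (auto simp: norm_eq_sqrt_inner)
    then show "(x \<bullet> x) * (norm (u x))\<^sup>2 \<le> b * (norm (u x))\<^sup>2" by (simp add: mult_right_mono)
    then show "(u x \<bullet> x)\<^sup>2 \<le> b * (norm (u x))\<^sup>2" using inner_square_le[of "u x" x] by (simp add: mult.commute)
  qed
  have bQ: "\<bar>?Q x * c\<bar> \<le> \<bar>c\<bar>" for x c
    using Q[of "m * (b - x \<bullet> x)"] by (auto simp: abs_mult intro: mult_left_le_one_le)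
  show bound: "\<bar>\<Phi> x\<bar> \<le> 4 * b * (indicator (cball 0 (sqrt b)) x * (norm (u x))\<^sup>2)" for x
  proof (cases "x \<in> cball 0 (sqrt b)")
    case True
    have "?P x / m \<le> b" using P(2)[of x] m by (simp add: field_simps)
    then have "?P x / m * (norm (u x))\<^sup>2 \<le> b * (norm (u x))\<^sup>2" by (rule mult_right_mono) simp
    moreover have "0 \<le> ?P x / m * (norm (u x))\<^sup>2" using P m by simp
    moreover have "\<bar>2 * (u x \<bullet> x)\<^sup>2 - (x \<bullet> x) * (norm (u x))\<^sup>2\<bar> \<le> 2 * (b * (norm (u x))\<^sup>2)"
    proof -
      have "0 \<le> (x \<bullet> x) * (norm (u x))\<^sup>2" "0 \<le> (u x \<bullet> x)\<^sup>2" by simp_all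
      with bd[OF True] show ?thesis by linarith
    qed
    moreover note bQ[of x "2 * (u x \<bullet> x)\<^sup>2 - (x \<bullet> x) * (norm (u x))\<^sup>2"]
    \<comment> \<open>The products are abstracted into variables so that only linear arithmetic
      remains. The two terms contribute at most \<open>c / 2\<close> and \<open>2 * c\<close>; the
      constant 4 is generous.\<close>
    moreover have "\<bar>p / 2 + q\<bar> \<le> 4 * c" if "p \<le> c" "0 \<le> p" "\<bar>d\<bar> \<le> 2 * c" "\<bar>q\<bar> \<le> \<bar>d\<bar>" for p q c d :: real
      using that by linarith
    ultimately have "\<bar>\<Phi> x\<bar> \<le> 4 * (b * (norm (u x))\<^sup>2)"
      unfolding \<Phi>_def by blast
    then show ?thesis using True by simp
  next
    case False
    then show ?thesis using supp[OF False] by (simp add: \<Phi>_def)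
  qed
  \<comment> \<open>\<open>L\<close> is the left integrand of the weak equation and
    \<open>- D\<close> is the pressure times the divergence. Combining their Bochner integrals into
    one requires both to be integrable; for \<open>D\<close> this follows from \<open>L\<close> and
    \<open>\<Phi>\<close>.\<close>
  define L where "L = (\<lambda>x. ?P x * (norm (u x))\<^sup>2 - 2 * m * ?Q x * (u x \<bullet> x)\<^sup>2)"
  define D where "D = (\<lambda>x. (norm (u x))\<^sup>2 / 2 * (3 * ?P x - 2 * m * ?Q x * (x \<bullet> x)))"
  have LD: "L x - D x = - m * \<Phi> x" for x
    using m by (simp add: L_def D_def \<Phi>_def field_simps)
  have L_int: "integrable lebesgue L"
  proof (rule L2_loc_integrable_bound[OF u])
    show "L \<in> borel_measurable lebesgue" unfolding L_def by measurable
    show "\<bar>L x\<bar> \<le> (3 * m * b) * (indicator (cball 0 (sqrt b)) x * (norm (u x))\<^sup>2)" for x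
    proof (cases "x \<in> cball 0 (sqrt b)")
      case True
      have "?P x * (norm (u x))\<^sup>2 \<le> m * b * (norm (u x))\<^sup>2" using P by (intro mult_right_mono) auto
      moreover have "0 \<le> ?P x * (norm (u x))\<^sup>2" using P by simp
      moreover have "\<bar>m * (?Q x * (u x \<bullet> x)\<^sup>2)\<bar> \<le> m * (b * (norm (u x))\<^sup>2)"
        using order_trans[OF bQ[of x "(u x \<bullet> x)\<^sup>2"]] bd[OF True] m by (simp add: abs_mult)
      ultimately have "\<bar>L x\<bar> \<le> 3 * (m * b * (norm (u x))\<^sup>2)"
        unfolding L_def by (simp add: mult.assoc)
      then show ?thesis using True by (simp add: mult.assoc)
    next
      case False
      then show ?thesis using supp[OF False] by (simp add: L_def)
    qed
  qed
  have \<Phi>_int: "integrable lebesgue \<Phi>"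
    by (rule L2_loc_integrable_bound[OF u meas bound])
  have D_eq: "D = (\<lambda>x. L x + m * \<Phi> x)" using LD by (auto simp: fun_eq_iff algebra_simps)
  have D_int: "integrable lebesgue D" unfolding D_eq using L_int \<Phi>_int by simp
  let ?\<phi> = "\<lambda>x::real^3. ?P x *\<^sub>R x"
  have 1: "(\<Sum>i\<in>UNIV. \<Sum>j\<in>UNIV. u x $ i * u x $ j * partial j (\<lambda>y. ?\<phi> y $ i) x) = L x" for x
    unfolding partial_flat_field L_def
    by (simp add: sum_3 inner_vec_def power2_norm_eq_inner) (simp add: algebra_simps power2_eq_square)
  have 2: "- ((norm (u x))\<^sup>2 / 2) * divergence ?\<phi> x = - D x" for x
    unfolding divergence_def partial_flat_field D_def
    by (simp add: sum_3 inner_vec_def) (simp add: algebra_simps power2_eq_square)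
  have "(\<integral>x. L x \<partial>lebesgue) = (\<integral>x. D x \<partial>lebesgue)"
    using weak[unfolded weak_euler_def, rule_format, OF test_field_flat_field[OF m, of b]]
    unfolding 1 2 by simp
  then have "(\<integral>x. L x - D x \<partial>lebesgue) = 0"
    using L_int D_int by simp
  then show "(\<integral>x. \<Phi> x \<partial>lebesgue) = 0"
    unfolding LD using m by simp
qed

text \<open>Dominated convergence along \<open>m = n + 1\<close> replaces the smooth fields by the
  Lipschitz field \<open>max (r^2 - |x|^2) 0 * x\<close>, with \<open>b = r^2\<close>. The limiting
  integrand is then split into a difference of two nonnegative functions, so that the identity can
  be stated without subtraction of integrals.\<close>

lemma weak_euler_radial_identity:
  fixes u :: "real^3 \<Rightarrow> real^3"
  assumes u: "L2_loc u" and weak: "weak_euler u (\<lambda>x. - ((norm (u x))\<^sup>2 / 2))"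
    and r: "r > 0"
  shows "(\<integral>\<^sup>+x\<in>ball 0 r. ennreal ((norm x)\<^sup>2 * (norm (u x))\<^sup>2 - (u x \<bullet> x)\<^sup>2) \<partial>lebesgue) =
    (\<integral>\<^sup>+x\<in>ball 0 r. ennreal ((u x \<bullet> x)\<^sup>2 + (r\<^sup>2 - (norm x)\<^sup>2) / 2 * (norm (u x))\<^sup>2) \<partial>lebesgue)"
proof -
  define b where "b = r\<^sup>2"
  have b: "b > 0" and sb: "sqrt b = r" using r by (auto simp: b_def)
  have um[measurable]: "u \<in> borel_measurable lebesgue" using u by (simp add: L2_loc_def)
  have id[measurable]: "(\<lambda>x::real^3. x) \<in> borel_measurable lebesgue"
    by (intro measurable_completion) simp
  define s where "s n x = flat 0 (real (Suc n) * (b - x \<bullet> x)) / real (Suc n) * (norm (u x))\<^sup>2 / 2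
      + flat (Suc 0) (real (Suc n) * (b - x \<bullet> x)) * (2 * (u x \<bullet> x)\<^sup>2 - (x \<bullet> x) * (norm (u x))\<^sup>2)" for n x
  define f where "f x = max (b - x \<bullet> x) 0 * (norm (u x))\<^sup>2 / 2
      + indicator {0<..} (b - x \<bullet> x) * (2 * (u x \<bullet> x)\<^sup>2 - (x \<bullet> x) * (norm (u x))\<^sup>2)" for x
  have lim: "(\<lambda>n. s n x) \<longlonglongrightarrow> f x" for x
    unfolding s_def f_def by (intro tendsto_intros flat_limit flat_1_limit) auto
  have w: "integrable lebesgue (\<lambda>x. 4 * b * (indicator (cball 0 (sqrt b)) x * (norm (u x))\<^sup>2))"
    using u by (auto simp: L2_loc_def set_integrable_def)
  have fm: "f \<in> borel_measurable lebesgue" unfolding f_def by measurable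
  have s: "s n \<in> borel_measurable lebesgue"
      "\<bar>s n x\<bar> \<le> 4 * b * (indicator (cball 0 (sqrt b)) x * (norm (u x))\<^sup>2)"
      "(\<integral>x. s n x \<partial>lebesgue) = 0" for n x
    using weak_euler_flat_field[OF u weak _ b, of "real (Suc n)"] unfolding s_def by auto
  have "(\<lambda>n. \<integral>x. s n x \<partial>lebesgue) \<longlonglongrightarrow> (\<integral>x. f x \<partial>lebesgue)"
    by (rule integral_dominated_convergence[OF fm s(1) w]) (use lim s(2) in auto)
  then have f0: "(\<integral>x. f x \<partial>lebesgue) = 0"
    using s(3) by (simp add: LIMSEQ_const_iff)
  have [measurable]: "ball (0::real^3) r \<in> sets borel" by simp
  \<comment> \<open>The term \<open>2 (u . x)^2\<close> is shared equally between the two sides.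
    This makes \<open>A\<close> nonnegative by Cauchy-Schwarz: on the ball it is
    \<open>|x|^2\<close> times the squared tangential part.\<close>
  define A where "A x = indicator (ball 0 r) x * ((norm x)\<^sup>2 * (norm (u x))\<^sup>2 - (u x \<bullet> x)\<^sup>2)" for x
  define B where "B x = indicator (ball 0 r) x * ((u x \<bullet> x)\<^sup>2 + (r\<^sup>2 - (norm x)\<^sup>2) / 2 * (norm (u x))\<^sup>2)" for x
  have in_ball: "0 < b - x \<bullet> x \<longleftrightarrow> x \<in> ball 0 r" for x :: "real^3"
    using r power_mono_iff[of r "norm x" 2] by (simp add: b_def power2_norm_eq_inner[symmetric] linorder_not_le[symmetric] del: not_le)
  have fAB: "f x = B x - A x" for x
    using in_ball[of x] unfolding f_def A_def B_def b_def[symmetric]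
    by (auto split: split_indicator simp: power2_norm_eq_inner max_def field_simps)
  have cs: "(u x \<bullet> x)\<^sup>2 \<le> (norm x)\<^sup>2 * (norm (u x))\<^sup>2" for x
    using inner_square_le[of "u x" x] by (simp add: power2_norm_eq_inner mult.commute)
  have A0: "0 \<le> A x" for x using cs[of x] by (auto simp: A_def split: split_indicator)
  have nx: "(norm x)\<^sup>2 \<le> b" if "x \<in> ball 0 r" for x :: "real^3"
    using that r by (auto simp: b_def intro: power_mono)
  have B0: "0 \<le> B x" for x using nx[of x] by (auto simp: B_def b_def split: split_indicator)
  have Ai: "integrable lebesgue A"
  proof (rule L2_loc_integrable_bound[OF u])
    show "A \<in> borel_measurable lebesgue" unfolding A_def by measurable
    show "\<bar>A x\<bar> \<le> b * (indicator (cball 0 r) x * (norm (u x))\<^sup>2)" for x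
    proof (cases "x \<in> ball 0 r")
      case True
      have "A x \<le> (norm x)\<^sup>2 * (norm (u x))\<^sup>2" using True by (simp add: A_def)
      also have "\<dots> \<le> b * (norm (u x))\<^sup>2" using nx[OF True] by (intro mult_right_mono) auto
      finally show ?thesis using A0[of x] True by simp
    next
      case False
      then show ?thesis using b by (simp add: A_def)
    qed
  qed
  have fi: "integrable lebesgue f"
    by (rule integrable_dominated_convergence[where s = s, OF fm s(1) w]) (use lim s(2) in auto)
  have Beq: "B = (\<lambda>x. f x + A x)" using fAB by (auto simp: fun_eq_iff)
  have Bi: "integrable lebesgue B" unfolding Beq using fi Ai by simp
  have "(\<integral>x. B x \<partial>lebesgue) = (\<integral>x. A x \<partial>lebesgue)"
    using f0 Ai Bi unfolding fAB by simp
  then have "(\<integral>\<^sup>+x. ennreal (A x) \<partial>lebesgue) = (\<integral>\<^sup>+x. ennreal (B x) \<partial>lebesgue)"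
    using nn_integral_eq_integral[OF Ai] nn_integral_eq_integral[OF Bi] A0 B0 by simp
  moreover have "ennreal (A x) = ennreal ((norm x)\<^sup>2 * (norm (u x))\<^sup>2 - (u x \<bullet> x)\<^sup>2) * indicator (ball 0 r) x"
    "ennreal (B x) = ennreal ((u x \<bullet> x)\<^sup>2 + (r\<^sup>2 - (norm x)\<^sup>2) / 2 * (norm (u x))\<^sup>2) * indicator (ball 0 r) x"
    for x by (auto simp: A_def B_def split: split_indicator)
  ultimately show ?thesis by simp
qed

subsection \<open>Energy in balls and on spheres\<close>

lemma sets_sphere_measure [simp, measurable_cong]: "sets (sphere_measure r) = sets borel"
  by (simp add: sphere_measure_def)

lemma nn_integral_polar_radial:
  fixes g :: "real^3 \<Rightarrow> ennreal"
  assumes [measurable]: "g \<in> borel_measurable borel" "w \<in> borel_measurable borel"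
  shows "(\<integral>\<^sup>+x. w (norm x) * g x \<partial>lborel) =
    (\<integral>\<^sup>+r. w r * ((\<integral>\<^sup>+x. g x \<partial>sphere_measure r) * indicator {0<..} r) \<partial>lborel)"
  by (subst nn_integral_polar)
    (auto intro!: nn_integral_cong simp: nn_integral_sphere_measure_radial split: split_indicator)

definition ball_mass :: "(real^3 \<Rightarrow> ennreal) \<Rightarrow> real \<Rightarrow> ennreal" where
  "ball_mass q r = (\<integral>\<^sup>+x. q x * indicator {..<r} (norm x) \<partial>lborel)"

text \<open>The integrand becomes the indicator of a fixed set composed with a Borel map of
  \<open>r\<close> and \<open>x\<close>, hence visibly jointly measurable.\<close>

lemma ball_mass_alt: "ball_mass q r = (\<integral>\<^sup>+x. q x * indicator {0<..} (r - norm x) \<partial>lborel)"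
  unfolding ball_mass_def by (auto intro!: nn_integral_cong split: split_indicator)

lemma borel_measurable_ball_mass [measurable]:
  assumes [measurable]: "q \<in> borel_measurable borel"
  shows "ball_mass q \<in> borel_measurable borel"
  unfolding ball_mass_alt by measurable

text \<open>Tonelli: the point \<open>x\<close> lies in the open ball of radius \<open>r\<close>
  exactly when \<open>r\<close> exceeds \<open>norm x\<close>.\<close>

lemma nn_integral_ball_mass:
  assumes [measurable]: "q \<in> borel_measurable borel" "w \<in> borel_measurable borel"
  shows "(\<integral>\<^sup>+r. w r * ball_mass q r \<partial>lborel) =
    (\<integral>\<^sup>+x. q x * (\<integral>\<^sup>+r. w r * indicator {norm x<..} r \<partial>lborel) \<partial>lborel)"
proof -
  have "(\<integral>\<^sup>+r. w r * ball_mass q r \<partial>lborel) =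
      (\<integral>\<^sup>+r. (\<integral>\<^sup>+x. w r * (q x * indicator {0<..} (r - norm x)) \<partial>lborel) \<partial>lborel)"
    by (intro nn_integral_cong) (simp add: ball_mass_alt nn_integral_cmult)
  also have "\<dots> = (\<integral>\<^sup>+x. (\<integral>\<^sup>+r. w r * (q x * indicator {0<..} (r - norm x)) \<partial>lborel) \<partial>lborel)"
    by (rule lborel_pair.Fubini'[symmetric]) measurable
  also have "\<dots> = (\<integral>\<^sup>+x. (\<integral>\<^sup>+r. q x * (w r * indicator {norm x<..} r) \<partial>lborel) \<partial>lborel)"
    by (intro nn_integral_cong) (auto simp: mult_ac split: split_indicator)
  also have "\<dots> = (\<integral>\<^sup>+x. q x * (\<integral>\<^sup>+r. w r * indicator {norm x<..} r \<partial>lborel) \<partial>lborel)"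
    by (intro nn_integral_cong nn_integral_cmult) measurable
  finally show ?thesis .
qed

lemma nn_integral_FTC_Ioo:
  fixes f :: "real \<Rightarrow> real"
  assumes [measurable]: "f \<in> borel_measurable borel"
    and "\<And>x. x \<in> {a..b} \<Longrightarrow> DERIV F x :> f x" "\<And>x. x \<in> {a..b} \<Longrightarrow> 0 \<le> f x" and "a \<le> b"
  shows "(\<integral>\<^sup>+x. ennreal (f x) * indicator {a<..<b} x \<partial>lborel) = ennreal (F b - F a)"
proof -
  have "(\<integral>\<^sup>+x. ennreal (f x) * indicator {a<..<b} x \<partial>lborel) =
      (\<integral>\<^sup>+x. ennreal (f x) * indicator {a..b} x \<partial>lborel)"
    using AE_lborel_singleton[of a] AE_lborel_singleton[of b]
    by (intro nn_integral_cong_AE, eventually_elim) (auto split: split_indicator)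
  also have "\<dots> = ennreal (F b - F a)"
    using assms by (intro nn_integral_FTC_Icc) auto
  finally show ?thesis .
qed

text \<open>Here \<open>a\<close> and \<open>c\<close> stand for the squared normal and tangential
  parts. The hypothesis \<open>id\<close> says that two nonnegative functions of the radius,
  \<open>F\<close> and \<open>G\<close>, have equal integrals up to every \<open>p\<close>. Regarded
  as densities they define the same measure, so they agree almost everywhere; this takes the place
  of differentiating \<open>id\<close> in \<open>r\<close>.\<close>

lemma AE_spherical_identity:
  fixes a c :: "real^3 \<Rightarrow> ennreal"
  assumes [measurable]: "a \<in> borel_measurable borel" "c \<in> borel_measurable borel"
    and fin: "\<And>r. ball_mass (\<lambda>x. a x + c x) r < \<infinity>"
    and id: "\<And>r. r > 0 \<Longrightarrow>
      (\<integral>\<^sup>+x. ennreal ((norm x)\<^sup>2) * indicator {..<r} (norm x) * c x \<partial>lborel) =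
      (\<integral>\<^sup>+x. ennreal ((norm x)\<^sup>2) * indicator {..<r} (norm x) * a x \<partial>lborel)
      + (\<integral>\<^sup>+x. ennreal ((r\<^sup>2 - (norm x)\<^sup>2) / 2) * indicator {..<r} (norm x) * (a x + c x) \<partial>lborel)"
  shows "AE r in lborel. r > 0 \<longrightarrow> (\<integral>\<^sup>+x. c x \<partial>sphere_measure r) =
    (\<integral>\<^sup>+x. a x \<partial>sphere_measure r) + ennreal (1 / r) * ball_mass (\<lambda>x. a x + c x) r"
proof -
  let ?S = "\<lambda>g r. (\<integral>\<^sup>+x. g x \<partial>sphere_measure r) * indicator {0<..} r"
  let ?M = "ball_mass (\<lambda>x. a x + c x)"
  have [measurable]: "?S a \<in> borel_measurable borel" "?S c \<in> borel_measurable borel"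
    by (intro borel_measurable_nn_integral_sphere_measure; measurable)+
  define F where "F r = ennreal (r\<^sup>2) * ?S c r" for r
  define G where "G r = ennreal (r\<^sup>2) * ?S a r + ennreal r * indicator {0<..} r * ?M r" for r
  have [measurable]: "F \<in> borel_measurable borel" "G \<in> borel_measurable borel"
    unfolding F_def G_def by measurable
  have Fval: "(\<integral>\<^sup>+r. F r * indicator {..<p} r \<partial>lborel) =
      (\<integral>\<^sup>+x. ennreal ((norm x)\<^sup>2) * indicator {..<p} (norm x) * c x \<partial>lborel)" for p
    unfolding F_def by (subst nn_integral_polar_radial) (auto intro!: nn_integral_cong simp: mult_ac)
  \<comment> \<open>The weight \<open>(p^2 - |x|^2) / 2\<close> is the integral of \<open>r\<close>
    from \<open>norm x\<close> to \<open>p\<close>. By Tonelli it therefore produces the term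
    \<open>r * M(r)\<close> of \<open>G\<close>.\<close>
  have inner: "(\<integral>\<^sup>+r. ennreal r * indicator {0<..} r * indicator {..<p} r * indicator {norm x<..} r \<partial>lborel) =
      ennreal ((p\<^sup>2 - (norm x)\<^sup>2) / 2) * indicator {..<p} (norm x)" for p and x :: "real^3"
  proof (cases "norm x < p")
    case True
    have "(\<integral>\<^sup>+r. ennreal r * indicator {0<..} r * indicator {..<p} r * indicator {norm x<..} r \<partial>lborel) =
        (\<integral>\<^sup>+r. ennreal r * indicator {norm x<..<p} r \<partial>lborel)"
      by (intro nn_integral_cong) (auto simp: ennreal_neg split: split_indicator)
    also have "\<dots> = ennreal (p\<^sup>2 / 2 - (norm x)\<^sup>2 / 2)"
      using True by (intro nn_integral_FTC_Ioo)
        (auto intro!: derivative_eq_intros intro: order_trans[OF norm_ge_zero])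
    finally show ?thesis using True by (simp add: diff_divide_distrib)
  next
    case False
    then have "(\<integral>\<^sup>+r. ennreal r * indicator {0<..} r * indicator {..<p} r * indicator {norm x<..} r \<partial>lborel) =
        (\<integral>\<^sup>+r. 0 \<partial>(lborel :: real measure))"
      by (intro nn_integral_cong) (auto split: split_indicator)
    then show ?thesis using False by simp
  qed
  have Gval: "(\<integral>\<^sup>+r. G r * indicator {..<p} r \<partial>lborel) =
      (\<integral>\<^sup>+x. ennreal ((norm x)\<^sup>2) * indicator {..<p} (norm x) * a x \<partial>lborel)
      + (\<integral>\<^sup>+x. ennreal ((p\<^sup>2 - (norm x)\<^sup>2) / 2) * indicator {..<p} (norm x) * (a x + c x) \<partial>lborel)" for p
  proof -
    have "(\<integral>\<^sup>+r. G r * indicator {..<p} r \<partial>lborel) =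
        (\<integral>\<^sup>+r. ennreal (r\<^sup>2) * indicator {..<p} r * ?S a r
          + ennreal r * indicator {0<..} r * indicator {..<p} r * ?M r \<partial>lborel)"
      unfolding G_def by (intro nn_integral_cong) (auto split: split_indicator)
    also have "\<dots> = (\<integral>\<^sup>+r. ennreal (r\<^sup>2) * indicator {..<p} r * ?S a r \<partial>lborel)
        + (\<integral>\<^sup>+r. ennreal r * indicator {0<..} r * indicator {..<p} r * ?M r \<partial>lborel)"
      by (rule nn_integral_add) measurable
    also have "(\<integral>\<^sup>+r. ennreal (r\<^sup>2) * indicator {..<p} r * ?S a r \<partial>lborel) =
        (\<integral>\<^sup>+x. ennreal ((norm x)\<^sup>2) * indicator {..<p} (norm x) * a x \<partial>lborel)"
      by (rule nn_integral_polar_radial[symmetric]) measurable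
    also have "(\<integral>\<^sup>+r. ennreal r * indicator {0<..} r * indicator {..<p} r * ?M r \<partial>lborel) =
        (\<integral>\<^sup>+x. ennreal ((p\<^sup>2 - (norm x)\<^sup>2) / 2) * indicator {..<p} (norm x) * (a x + c x) \<partial>lborel)"
      by (subst nn_integral_ball_mass, measurable) (unfold inner, simp add: mult.commute)
    finally show ?thesis .
  qed
  have dens: "emeasure (density lborel F) {..<p} = emeasure (density lborel G) {..<p}" for p
  proof (cases "p > 0")
    case True
    then show ?thesis using id[OF True] by (simp add: emeasure_density Fval Gval)
  next
    case False
    then have "indicator {..<p} (norm x) = (0::ennreal)" for x :: "real^3"
      using norm_ge_zero[of x] by (auto split: split_indicator simp del: norm_ge_zero)
    then show ?thesis by (simp add: emeasure_density Fval Gval)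
  qed
  have dfin: "emeasure (density lborel F) {..<p} \<noteq> \<infinity>" for p
  proof -
    have "emeasure (density lborel F) {..<p} =
        (\<integral>\<^sup>+x. ennreal ((norm x)\<^sup>2) * indicator {..<p} (norm x) * c x \<partial>lborel)"
      by (simp add: emeasure_density Fval)
    also have "\<dots> \<le> (\<integral>\<^sup>+x. ennreal (p\<^sup>2) * ((a x + c x) * indicator {..<p} (norm x)) \<partial>lborel)"
    proof (rule nn_integral_mono)
      fix x
      show "ennreal ((norm x)\<^sup>2) * indicator {..<p} (norm x) * c x
          \<le> ennreal (p\<^sup>2) * ((a x + c x) * indicator {..<p} (norm x))"
        by (auto split: split_indicator intro!: mult_mono power_mono ennreal_leI add_increasing)
    qed
    also have "\<dots> = ennreal (p\<^sup>2) * ?M p"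
      unfolding ball_mass_def by (rule nn_integral_cmult) measurable
    also have "\<dots> < \<infinity>" using fin[of p] by (simp add: ennreal_mult_less_top)
    finally show ?thesis by simp
  qed
  \<comment> \<open>The half-lines are stable under intersection, generate the Borel sets and have
    finite mass for both densities, so equality on them extends to all Borel sets.\<close>
  have "density lborel F = density lborel G"
  proof (rule measure_eqI_generator_eq[where E = "range lessThan" and \<Omega> = UNIV and A = "\<lambda>n. {..<real n}"])
    show "Int_stable (range (lessThan :: real \<Rightarrow> real set))"
    proof (rule Int_stableI_image)
      show "\<exists>k\<in>UNIV. {..<i} \<inter> {..<j} = {..<k}" for i j :: real
        by (intro bexI[of _ "min i j"]) auto
    qed
    have "sets borel = sigma_sets UNIV (range (lessThan :: real \<Rightarrow> real set))"
      by (subst borel_Iio) (simp add: sets_measure_of)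
    then show "sets (density lborel F) = sigma_sets UNIV (range lessThan)"
      "sets (density lborel G) = sigma_sets UNIV (range lessThan)" by simp_all
    show "(\<Union>n. {..<real n}) = UNIV"
      using reals_Archimedean2 by auto
  qed (use dens dfin in auto)
  then have "AE r in lborel. F r = G r"
    by (intro sigma_finite_measure.density_unique[OF sigma_finite_lborel]) measurable
  then show ?thesis
  proof eventually_elim
    case (elim r)
    show ?case
    proof
      assume r: "r > 0"
      let ?i = "ennreal (1 / r\<^sup>2)"
      have *: "?i * ennreal (r\<^sup>2) = 1" "?i * ennreal r = ennreal (1 / r)"
        using r by (simp_all add: ennreal_mult'[symmetric] power2_eq_square)
      have "?i * (ennreal (r\<^sup>2) * (\<integral>\<^sup>+x. c x \<partial>sphere_measure r)) =
        ?i * (ennreal (r\<^sup>2) * (\<integral>\<^sup>+x. a x \<partial>sphere_measure r) + ennreal r * ?M r)"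
        using elim r by (simp add: F_def G_def)
      then show "(\<integral>\<^sup>+x. c x \<partial>sphere_measure r) = (\<integral>\<^sup>+x. a x \<partial>sphere_measure r) + ennreal (1 / r) * ?M r"
        by (simp add: distrib_left mult.assoc[symmetric] *)
    qed
  qed
qed

text \<open>The integral \<open>A\<close> of \<open>q / |x|\<close> over the shell, with
  \<open>q = a + c\<close>, is computed twice. The spherical identity gives
  \<open>A = 2 I + V\<close>, where \<open>V\<close> integrates \<open>M(r) / r^2\<close>. An
  integration by parts, carried out with Tonelli, gives \<open>V + M(R) / R\<close> as
  \<open>A\<close> plus the inner boundary term. Cancelling \<open>V\<close> leaves the
  claim.\<close>

lemma ball_mass_identity:
  fixes a c :: "real^3 \<Rightarrow> ennreal"
  assumes [measurable]: "a \<in> borel_measurable borel" "c \<in> borel_measurable borel"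
    and fin: "\<And>r. ball_mass (\<lambda>x. a x + c x) r < \<infinity>"
    and sph: "AE r in lborel. r > 0 \<longrightarrow> (\<integral>\<^sup>+x. c x \<partial>sphere_measure r) =
      (\<integral>\<^sup>+x. a x \<partial>sphere_measure r) + ennreal (1 / r) * ball_mass (\<lambda>x. a x + c x) r"
    and e: "0 < e" "e < R"
  shows "ennreal (1 / R) * ball_mass (\<lambda>x. a x + c x) R =
    2 * (\<integral>\<^sup>+x. ennreal (1 / norm x) * indicator {e<..<R} (norm x) * a x \<partial>lborel)
    + ennreal (1 / e) * (\<integral>\<^sup>+x. (a x + c x) * indicator {..e} (norm x) \<partial>lborel)"
proof -
  let ?S = "\<lambda>g r. (\<integral>\<^sup>+x. g x \<partial>sphere_measure r) * indicator {0<..} r"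
  let ?q = "\<lambda>x. a x + c x"
  let ?M = "ball_mass ?q"
  have [measurable]: "?S a \<in> borel_measurable borel" "?S c \<in> borel_measurable borel"
    by (intro borel_measurable_nn_integral_sphere_measure; measurable)+
  define w where "w r = ennreal (1 / r) * indicator {e<..<R} r" for r
  have [measurable]: "w \<in> borel_measurable borel" unfolding w_def by measurable
  define v where "v r = ennreal (1 / r\<^sup>2) * indicator {e<..<R} r" for r
  have [measurable]: "v \<in> borel_measurable borel" unfolding v_def by measurable
  define A where "A = (\<integral>\<^sup>+x. w (norm x) * ?q x \<partial>lborel)"
  define I where "I = (\<integral>\<^sup>+x. w (norm x) * a x \<partial>lborel)"
  define V where "V = (\<integral>\<^sup>+r. v r * ?M r \<partial>lborel)"
  have "A = (\<integral>\<^sup>+r. w r * ?S ?q r \<partial>lborel)"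
    unfolding A_def by (rule nn_integral_polar_radial) measurable
  \<comment> \<open>On almost every sphere \<open>sph\<close> rewrites the sum of both parts as
    twice the normal part plus \<open>M(r) / r\<close>; the weight \<open>1 / r\<close> turns the
    last term into \<open>M(r) / r^2\<close>.\<close>
  also have "\<dots> = (\<integral>\<^sup>+r. 2 * (w r * ?S a r) + v r * ?M r \<partial>lborel)"
  proof (rule nn_integral_cong_AE, use sph in eventually_elim)
    case (elim r)
    show ?case
    proof (cases "r \<in> {e<..<R}")
      case True
      then have r: "r > 0" using e by simp
      have "(\<integral>\<^sup>+x. ?q x \<partial>sphere_measure r) = (\<integral>\<^sup>+x. a x \<partial>sphere_measure r) + (\<integral>\<^sup>+x. c x \<partial>sphere_measure r)"
        by (rule nn_integral_add) measurable
      moreover have "ennreal (1 / r) * ennreal (1 / r) = ennreal (1 / r\<^sup>2)"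
        using r by (simp add: ennreal_mult'[symmetric] power2_eq_square)
      ultimately show ?thesis
        using elim r by (simp add: w_def v_def distrib_left mult.assoc[symmetric] split: split_indicator)
          (simp add: mult_2 distrib_right distrib_left add.assoc)
    qed (simp add: w_def v_def)
  qed
  also have "\<dots> = (\<integral>\<^sup>+r. 2 * (w r * ?S a r) \<partial>lborel) + V"
    unfolding V_def by (rule nn_integral_add) measurable
  also have "(\<integral>\<^sup>+r. 2 * (w r * ?S a r) \<partial>lborel) = 2 * I"
    unfolding I_def by (subst nn_integral_polar_radial; (measurable)?) (rule nn_integral_cmult, measurable)
  finally have A1: "A = 2 * I + V" .
  \<comment> \<open>For \<open>s < R\<close> the integral of \<open>v\<close> beyond
    \<open>s\<close> is \<open>1 / max e s - 1 / R\<close>. This leaves \<open>1 / e\<close> on the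
    closed ball of radius \<open>e\<close> and \<open>1 / s\<close> outside it; the ball is closed
    because the shell defining \<open>w\<close> omits the radius \<open>e\<close>.\<close>
  have inner: "(\<integral>\<^sup>+r. v r * indicator {s<..} r \<partial>lborel) + ennreal (1 / R) * indicator {..<R} s =
      ennreal (1 / e) * indicator {..e} s + w s" for s :: real
  proof (cases "s < R")
    case True
    have "(\<integral>\<^sup>+r. v r * indicator {s<..} r \<partial>lborel) =
      (\<integral>\<^sup>+r. ennreal (1 / r\<^sup>2) * indicator {max e s<..<R} r \<partial>lborel)"
      unfolding v_def by (intro nn_integral_cong) (auto split: split_indicator)
    also have "\<dots> = ennreal (- (1 / R) - (- (1 / max e s)))"
    proof (rule nn_integral_FTC_Ioo)
      show "((\<lambda>r. - (1 / r)) has_real_derivative 1 / x\<^sup>2) (at x)" if "x \<in> {max e s..R}" for x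
        using that e by (auto intro!: derivative_eq_intros simp: power2_eq_square)
    qed (use True e in auto)
    finally have 1: "(\<integral>\<^sup>+r. v r * indicator {s<..} r \<partial>lborel) = ennreal (1 / max e s - 1 / R)"
      by simp
    have "1 / R \<le> 1 / max e s" using True e by (intro divide_left_mono) auto
    then have "ennreal (1 / max e s - 1 / R) + ennreal (1 / R) = ennreal (1 / max e s)"
      using e by (subst ennreal_plus[symmetric]) auto
    with 1 show ?thesis
      using True by (auto simp: w_def max_def split: split_indicator)
  next
    case False
    then have "(\<integral>\<^sup>+r. v r * indicator {s<..} r \<partial>lborel) = (\<integral>\<^sup>+r. 0 \<partial>(lborel :: real measure))"
      by (intro nn_integral_cong) (auto simp: v_def split: split_indicator)
    then show ?thesis using False e by (auto simp: w_def split: split_indicator)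
  qed
  have "V + ennreal (1 / R) * ?M R =
      (\<integral>\<^sup>+x. ?q x * (\<integral>\<^sup>+r. v r * indicator {norm x<..} r \<partial>lborel) \<partial>lborel)
      + (\<integral>\<^sup>+x. ennreal (1 / R) * (?q x * indicator {..<R} (norm x)) \<partial>lborel)"
    unfolding V_def by (subst nn_integral_ball_mass, measurable) (simp add: ball_mass_def nn_integral_cmult)
  also have "\<dots> = (\<integral>\<^sup>+x. ?q x * (\<integral>\<^sup>+r. v r * indicator {norm x<..} r \<partial>lborel)
      + ennreal (1 / R) * (?q x * indicator {..<R} (norm x)) \<partial>lborel)"
  proof (rule nn_integral_add[symmetric])
    have "(\<lambda>x. ?q x * (\<integral>\<^sup>+r. v r * indicator {0<..} (r - norm x) \<partial>lborel)) \<in> borel_measurable lborel"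
      by measurable
    then show "(\<lambda>x. ?q x * (\<integral>\<^sup>+r. v r * indicator {norm x<..} r \<partial>lborel)) \<in> borel_measurable lborel"
      by (simp add: indicator_def)
  qed measurable
  also have "\<dots> = (\<integral>\<^sup>+x. ?q x * ((\<integral>\<^sup>+r. v r * indicator {norm x<..} r \<partial>lborel)
      + ennreal (1 / R) * indicator {..<R} (norm x)) \<partial>lborel)"
    by (intro nn_integral_cong) (auto split: split_indicator simp: distrib_left mult.commute)
  also have "\<dots> = (\<integral>\<^sup>+x. ennreal (1 / e) * (?q x * indicator {..e} (norm x)) + w (norm x) * ?q x \<partial>lborel)"
    unfolding inner by (simp add: distrib_left mult_ac)
  also have "\<dots> = (\<integral>\<^sup>+x. ennreal (1 / e) * (?q x * indicator {..e} (norm x)) \<partial>lborel) + A"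
    unfolding A_def by (rule nn_integral_add) measurable
  also have "(\<integral>\<^sup>+x. ennreal (1 / e) * (?q x * indicator {..e} (norm x)) \<partial>lborel) =
      ennreal (1 / e) * (\<integral>\<^sup>+x. ?q x * indicator {..e} (norm x) \<partial>lborel)"
    by (rule nn_integral_cmult) measurable
  finally have A2: "V + ennreal (1 / R) * ?M R =
    ennreal (1 / e) * (\<integral>\<^sup>+x. ?q x * indicator {..e} (norm x) \<partial>lborel) + A" .
  \<comment> \<open>Cancellation of \<open>V\<close> in the extended nonnegative reals requires
    \<open>V\<close> to be finite. This follows from \<open>V <= A\<close> and the bound of
    \<open>1 / |x|\<close> by \<open>1 / e\<close> on the shell.\<close>
  have "A \<le> (\<integral>\<^sup>+x. ennreal (1 / e) * (?q x * indicator {..<R} (norm x)) \<partial>lborel)"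
    unfolding A_def
  proof (rule nn_integral_mono)
    fix x
    show "w (norm x) * ?q x \<le> ennreal (1 / e) * (?q x * indicator {..<R} (norm x))"
      using e by (auto simp: w_def split: split_indicator intro!: mult_right_mono ennreal_leI divide_left_mono mult_pos_pos)
  qed
  also have "\<dots> = ennreal (1 / e) * ?M R"
    unfolding ball_mass_def by (rule nn_integral_cmult) measurable
  also have "\<dots> < \<infinity>" using fin[of R] by (simp add: ennreal_mult_less_top)
  finally have "A \<noteq> \<infinity>" by simp
  then have "V \<noteq> \<infinity>" using A1 by auto
  moreover have "V + ennreal (1 / R) * ?M R =
      V + (2 * I + ennreal (1 / e) * (\<integral>\<^sup>+x. ?q x * indicator {..e} (norm x) \<partial>lborel))"
    using A2 unfolding A1 by (simp add: ac_simps)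
  ultimately show ?thesis
    unfolding ennreal_add_left_cancel I_def w_def by simp
qed

section \<open>Normal and tangential parts, and null sets on spheres\<close>

lemma norm_normal_part_eq: "(norm (normal_part u x))\<^sup>2 = (u x \<bullet> (x /\<^sub>R norm x))\<^sup>2"
proof (cases "x = 0")
  case False
  then have "norm (x /\<^sub>R norm x) = 1" by simp
  then show ?thesis
    unfolding normal_part_def by (metis norm_scaleR mult.right_neutral power2_abs)
qed (simp add: normal_part_def)

lemma norm_normal_part: "(norm x)\<^sup>2 * (norm (normal_part u x))\<^sup>2 = (u x \<bullet> x)\<^sup>2"
  by (cases "x = 0") (simp_all add: norm_normal_part_eq field_simps)

text \<open>Lagrange's identity for the cross product with the unit vector \<open>x / |x|\<close>.
  The origin is excluded because both parts take the default value 0 there.\<close>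

lemma norm_normal_tangential:
  assumes "x \<noteq> 0"
  shows "(norm (normal_part u x))\<^sup>2 + (norm (tangential_part u x))\<^sup>2 = (norm (u x))\<^sup>2"
  using assms norm_cross_dot[of "u x" "x /\<^sub>R norm x"]
  by (simp add: norm_normal_part_eq tangential_part_def)

text \<open>Polar coordinates applied to a Borel null set covering the exceptions. This transfers
  the equality of the tangential part with a Borel version from space to almost every
  sphere.\<close>

lemma AE_sphere_measure:
  assumes "AE x in lborel. P x"
  shows "AE r in lborel. r > 0 \<longrightarrow> (AE x in sphere_measure r. P x)"
proof -
  obtain N where N: "{x \<in> space lborel. \<not> P x} \<subseteq> N" "N \<in> sets lborel" "emeasure lborel N = 0"
    using AE_E[OF assms] by metis
  have [measurable]: "N \<in> sets borel" using N(2) by simp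
  let ?S = "\<lambda>r. (\<integral>\<^sup>+x. indicator N x \<partial>sphere_measure r) * indicator {0<..} r"
  have m: "?S \<in> borel_measurable lborel"
    using borel_measurable_nn_integral_sphere_measure[of "indicator N"] by simp
  have "(\<integral>\<^sup>+r. ?S r \<partial>lborel) = 0"
    using N by (subst nn_integral_polar[symmetric]) auto
  then have "AE r in lborel. ?S r = 0"
    using nn_integral_0_iff_AE[OF m] by simp
  then show ?thesis
  proof eventually_elim
    case (elim r)
    show ?case
    proof
      assume "r > 0"
      then have "emeasure (sphere_measure r) N = 0" using elim by simp
      then have "N \<in> null_sets (sphere_measure r)" by (auto intro: null_setsI)
      then show "AE x in sphere_measure r. P x"
        by (rule AE_I') (use N in auto)
    qed
  qed
qed

section \<open>The weighted inequality and the vanishing criterion\<close>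

text \<open>Changing \<open>u\<close> on a null set can change its integral over any single sphere,
  so sphere integrals are meaningful only for almost every radius. The decay condition therefore
  supplies, for each null set of radii, a sequence avoiding it.\<close>

theorem theorem1p3:
  fixes u :: "real^3 \<Rightarrow> real^3" and p :: "real^3 \<Rightarrow> real"
  assumes u_loc: "L2_loc u"
    and p_def: "\<And>x. p x = - ((norm (u x))\<^sup>2 / 2)"
    and weak: "weak_euler u p"
  shows "(\<forall>R::real. 0 < R \<longrightarrow>
           (\<integral>\<^sup>+ x\<in>ball 0 R. ennreal ((norm (normal_part u x))\<^sup>2 / norm x) \<partial>lebesgue)
             \<le> ennreal (1 / (2 * R)) * (\<integral>\<^sup>+ x\<in>ball 0 R. ennreal ((norm (u x))\<^sup>2) \<partial>lebesgue))
       \<and> ((\<forall>N \<in> null_sets lborel. \<exists>Rk :: nat \<Rightarrow> real.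
              (\<forall>k. 0 < Rk k \<and> Rk k \<notin> N) \<and> filterlim Rk at_top sequentially \<and>
              ((\<lambda>k. \<integral>\<^sup>+ x. ennreal ((norm (tangential_part u x))\<^sup>2) \<partial>sphere_measure (Rk k))
                 \<longlonglongrightarrow> 0))
          \<longrightarrow> (AE x in lebesgue. u x = 0))"
proof -
  have weak': "weak_euler u (\<lambda>x. - ((norm (u x))\<^sup>2 / 2))"
    using weak p_def by (simp add: weak_euler_def)
  have um: "u \<in> borel_measurable lebesgue" using u_loc by (simp add: L2_loc_def)
  have idm: "(\<lambda>x::real^3. x) \<in> borel_measurable lebesgue"
    by (intro measurable_completion) simp
  \<comment> \<open>The polar formulas are stated for Borel functions, whereas \<open>u\<close> is
    only Lebesgue measurable; \<open>a\<close> and \<open>c\<close> are Borel versions of the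
    squared normal and tangential parts.\<close>
  have "(\<lambda>x. ennreal ((norm (normal_part u x))\<^sup>2)) \<in> borel_measurable lebesgue"
    using um idm unfolding normal_part_def by measurable
  from completion_ex_borel_measurable[OF this]
  obtain a where [measurable]: "a \<in> borel_measurable borel"
      and a: "AE x in lborel. ennreal ((norm (normal_part u x))\<^sup>2) = a x"
    by auto
  \<comment> \<open>This expression is evidently measurable and equals the squared tangential part
    away from the origin.\<close>
  have "(\<lambda>x. ennreal ((norm (u x))\<^sup>2 - ((u x) \<bullet> (x /\<^sub>R norm x))\<^sup>2)) \<in> borel_measurable lebesgue"
    using um idm by measurable
  from completion_ex_borel_measurable[OF this]
  obtain c where [measurable]: "c \<in> borel_measurable borel"
      and c': "AE x in lborel. ennreal ((norm (u x))\<^sup>2 - ((u x) \<bullet> (x /\<^sub>R norm x))\<^sup>2) = c x"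
    by auto
  have c: "AE x in lborel. ennreal ((norm (tangential_part u x))\<^sup>2) = c x"
    using c' AE_lborel_singleton[of 0]
  proof eventually_elim
    case (elim x)
    then show ?case
      using norm_cross[of "u x" "x /\<^sub>R norm x"] by (simp add: tangential_part_def)
  qed
  let ?q = "\<lambda>x. a x + c x"
  let ?M = "ball_mass ?q"
  have q: "AE x in lborel. ennreal ((norm (u x))\<^sup>2) = ?q x"
    using a c AE_lborel_singleton[of 0]
    by eventually_elim (metis ennreal_plus norm_normal_tangential zero_le_power2)
  have M: "?M r = (\<integral>\<^sup>+x\<in>ball 0 r. ennreal ((norm (u x))\<^sup>2) \<partial>lebesgue)" for r
    unfolding ball_mass_def nn_integral_completion using q
    by (intro nn_integral_cong_AE, eventually_elim) (auto split: split_indicator)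
  have fin: "?M r < \<infinity>" for r
  proof -
    have "integrable lebesgue (\<lambda>x. indicator (cball 0 r) x * (norm (u x))\<^sup>2)"
      using u_loc by (auto simp: L2_loc_def set_integrable_def)
    then have "(\<integral>\<^sup>+x. ennreal (norm (indicator (cball 0 r) x * (norm (u x))\<^sup>2)) \<partial>lebesgue) < \<infinity>"
      by (simp add: integrable_iff_bounded)
    moreover have "?M r \<le> (\<integral>\<^sup>+x. ennreal (norm (indicator (cball 0 r) x * (norm (u x))\<^sup>2)) \<partial>lebesgue)"
      unfolding M by (intro nn_integral_mono) (auto split: split_indicator)
    ultimately show ?thesis by simp
  qed
  have id: "(\<integral>\<^sup>+x. ennreal ((norm x)\<^sup>2) * indicator {..<r} (norm x) * c x \<partial>lborel) =
      (\<integral>\<^sup>+x. ennreal ((norm x)\<^sup>2) * indicator {..<r} (norm x) * a x \<partial>lborel)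
      + (\<integral>\<^sup>+x. ennreal ((r\<^sup>2 - (norm x)\<^sup>2) / 2) * indicator {..<r} (norm x) * ?q x \<partial>lborel)"
    if r: "r > 0" for r
  proof -
    have "(\<integral>\<^sup>+x. ennreal ((norm x)\<^sup>2) * indicator {..<r} (norm x) * c x \<partial>lborel) =
      (\<integral>\<^sup>+x\<in>ball 0 r. ennreal ((norm x)\<^sup>2 * (norm (u x))\<^sup>2 - (u x \<bullet> x)\<^sup>2) \<partial>lborel)"
    proof (rule nn_integral_cong_AE, use c AE_lborel_singleton[of 0] in eventually_elim)
      case (elim x)
      have "(norm x)\<^sup>2 * (norm (tangential_part u x))\<^sup>2 = (norm x)\<^sup>2 * (norm (u x))\<^sup>2 - (u x \<bullet> x)\<^sup>2"
        using norm_normal_tangential[OF elim(2), of u] norm_normal_part[of x u]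
        by (metis add_diff_cancel_left' right_diff_distrib)
      then have "ennreal ((norm x)\<^sup>2) * c x = ennreal ((norm x)\<^sup>2 * (norm (u x))\<^sup>2 - (u x \<bullet> x)\<^sup>2)"
        by (simp add: elim(1)[symmetric] ennreal_mult'[symmetric])
      then show ?case by (auto split: split_indicator)
    qed
    also have "\<dots> = (\<integral>\<^sup>+x\<in>ball 0 r. ennreal ((u x \<bullet> x)\<^sup>2 + (r\<^sup>2 - (norm x)\<^sup>2) / 2 * (norm (u x))\<^sup>2) \<partial>lborel)"
      using weak_euler_radial_identity[OF u_loc weak' r] by (simp add: nn_integral_completion)
    also have "\<dots> = (\<integral>\<^sup>+x. ennreal ((norm x)\<^sup>2) * indicator {..<r} (norm x) * a x
        + ennreal ((r\<^sup>2 - (norm x)\<^sup>2) / 2) * indicator {..<r} (norm x) * ?q x \<partial>lborel)"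
    proof (rule nn_integral_cong_AE, use a q in eventually_elim)
      case (elim x)
      show ?case
      proof (cases "norm x < r")
        case True
        then have le: "(norm x)\<^sup>2 \<le> r\<^sup>2" by (intro power_mono) auto
        have split: "ennreal (A * B + C * D) = ennreal A * ennreal B + ennreal C * ennreal D"
          if "0 \<le> A" "0 \<le> B" "0 \<le> C" "0 \<le> D" for A B C D :: real
          using that by (simp add: ennreal_plus ennreal_mult)
        have "ennreal ((u x \<bullet> x)\<^sup>2 + (r\<^sup>2 - (norm x)\<^sup>2) / 2 * (norm (u x))\<^sup>2) =
            ennreal ((norm x)\<^sup>2) * a x + ennreal ((r\<^sup>2 - (norm x)\<^sup>2) / 2) * ?q x"
          unfolding norm_normal_part[symmetric] elim(2)[symmetric] unfolding elim(1)[symmetric]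
          by (rule split) (use le in auto)
        then show ?thesis using True by simp
      qed simp
    qed
    also have "\<dots> = (\<integral>\<^sup>+x. ennreal ((norm x)\<^sup>2) * indicator {..<r} (norm x) * a x \<partial>lborel)
      + (\<integral>\<^sup>+x. ennreal ((r\<^sup>2 - (norm x)\<^sup>2) / 2) * indicator {..<r} (norm x) * ?q x \<partial>lborel)"
      by (rule nn_integral_add) measurable
    finally show ?thesis .
  qed
  have sph: "AE r in lborel. r > 0 \<longrightarrow> (\<integral>\<^sup>+x. c x \<partial>sphere_measure r) =
      (\<integral>\<^sup>+x. a x \<partial>sphere_measure r) + ennreal (1 / r) * ?M r"
    by (rule AE_spherical_identity[OF _ _ fin id]) measurable
  have mass: "ennreal (1 / R) * ?M R =
      2 * (\<integral>\<^sup>+x. ennreal (1 / norm x) * indicator {e<..<R} (norm x) * a x \<partial>lborel)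
      + ennreal (1 / e) * (\<integral>\<^sup>+x. ?q x * indicator {..e} (norm x) \<partial>lborel)"
    if "0 < e" "e < R" for e R
    using that by (intro ball_mass_identity[OF _ _ fin sph]) measurable
  \<comment> \<open>Monotonicity of \<open>M(r) / r\<close>: the normal term in \<open>mass\<close>
    is nonnegative, and the closed ball of radius \<open>e\<close> contains the open one.\<close>
  have mono: "ennreal (1 / e) * ?M e \<le> ennreal (1 / R) * ?M R" if e: "0 < e" "e < R" for e R
  proof -
    have "?M e \<le> (\<integral>\<^sup>+x. ?q x * indicator {..e} (norm x) \<partial>lborel)"
      unfolding ball_mass_def by (intro nn_integral_mono) (auto split: split_indicator)
    then have "ennreal (1 / e) * ?M e \<le> ennreal (1 / e) * (\<integral>\<^sup>+x. ?q x * indicator {..e} (norm x) \<partial>lborel)"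
      by (rule mult_left_mono) simp
    also have "\<dots> \<le> ennreal (1 / R) * ?M R"
      unfolding mass[OF e] by (simp add: add_increasing)
    finally show ?thesis .
  qed
  show ?thesis
  proof (intro conjI allI impI)
    fix R :: real assume R: "0 < R"
    \<comment> \<open>The inner radii decrease to 0. The shift by 2 keeps them strictly below
      \<open>R\<close> already for \<open>n = 0\<close>, as \<open>mass\<close> demands.\<close>
    define f where "f n x = ennreal (1 / norm x) * indicator {R / real (n + 2)<..<R} (norm x) * a x" for n and x :: "real^3"
    have fm: "f n \<in> borel_measurable lborel" for n unfolding f_def by measurable
    have inc: "incseq f"
    proof (intro incseq_SucI le_funI)
      fix n x
      have "R / real (Suc n + 2) \<le> R / real (n + 2)" using R by (intro divide_left_mono) auto
      then show "f n x \<le> f (Suc n) x" unfolding f_def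
        by (intro mult_right_mono mult_left_mono) (auto split: split_indicator)
    qed
    have bnd: "(\<integral>\<^sup>+x. f n x \<partial>lborel) \<le> ennreal (1 / (2 * R)) * ?M R" for n
    proof -
      have "2 * (\<integral>\<^sup>+x. f n x \<partial>lborel) \<le> ennreal (1 / R) * ?M R"
        using R unfolding f_def
        by (subst mass[of "R / real (n + 2)"]) (auto simp: field_simps intro: add_pos_nonneg)
      then have "ennreal (1 / 2) * (2 * (\<integral>\<^sup>+x. f n x \<partial>lborel)) \<le> ennreal (1 / 2) * (ennreal (1 / R) * ?M R)"
        by (rule mult_left_mono) simp
      moreover have "ennreal (1 / 2) * 2 = 1"
        by (subst ennreal_numeral[symmetric], subst ennreal_mult'[symmetric]) auto
      moreover have "ennreal (1 / 2) * ennreal (1 / R) = ennreal (1 / (2 * R))"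
        using R by (subst ennreal_mult'[symmetric]) auto
      ultimately show ?thesis by (simp add: mult.assoc[symmetric])
    qed
    have "(\<integral>\<^sup>+x\<in>ball 0 R. ennreal ((norm (normal_part u x))\<^sup>2 / norm x) \<partial>lebesgue) =
        (\<integral>\<^sup>+x\<in>ball 0 R. ennreal ((norm (normal_part u x))\<^sup>2 / norm x) \<partial>lborel)"
      by (rule nn_integral_completion)
    \<comment> \<open>Every nonzero point of the ball lies in some shell, so there the truncated
      integrands reach the full one; monotone convergence then passes the uniform bound to the
      limit.\<close>
    also have "\<dots> \<le> (\<integral>\<^sup>+x. (SUP n. f n x) \<partial>lborel)"
    proof (rule nn_integral_mono_AE, use a AE_lborel_singleton[of 0] in eventually_elim)
      case (elim x)
      show ?case
      proof (cases "norm x < R")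
        case True
        obtain n :: nat where n: "R / norm x < real n" using reals_Archimedean2 by blast
        have "R / real (n + 2) < norm x"
        proof -
          have "R < real n * norm x" using n elim(2) by (simp add: field_simps)
          also have "\<dots> \<le> real (n + 2) * norm x" by (intro mult_right_mono) auto
          finally show ?thesis by (simp add: field_simps)
        qed
        then have "ennreal ((norm (normal_part u x))\<^sup>2 / norm x) = f n x"
          using True unfolding f_def elim(1)[symmetric]
          by (simp add: ennreal_mult'[symmetric])
        then show ?thesis using True by (auto intro: SUP_upper)
      qed simp
    qed
    also have "\<dots> = (SUP n. (\<integral>\<^sup>+x. f n x \<partial>lborel))"
      by (rule nn_integral_monotone_convergence_SUP[OF inc fm])
    also have "\<dots> \<le> ennreal (1 / (2 * R)) * ?M R"
      by (rule SUP_least) (rule bnd)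
    finally show "(\<integral>\<^sup>+x\<in>ball 0 R. ennreal ((norm (normal_part u x))\<^sup>2 / norm x) \<partial>lebesgue)
        \<le> ennreal (1 / (2 * R)) * (\<integral>\<^sup>+x\<in>ball 0 R. ennreal ((norm (u x))\<^sup>2) \<partial>lebesgue)"
      unfolding M .
  next
    assume dec: "\<forall>N \<in> null_sets lborel. \<exists>Rk :: nat \<Rightarrow> real.
      (\<forall>k. 0 < Rk k \<and> Rk k \<notin> N) \<and> filterlim Rk at_top sequentially \<and>
      ((\<lambda>k. \<integral>\<^sup>+ x. ennreal ((norm (tangential_part u x))\<^sup>2) \<partial>sphere_measure (Rk k)) \<longlonglongrightarrow> 0)"
    let ?T = "\<lambda>r. \<integral>\<^sup>+ x. ennreal ((norm (tangential_part u x))\<^sup>2) \<partial>sphere_measure r"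
    \<comment> \<open>Of the spherical identity only \<open>M(r) / r <= T(r)\<close> is kept, with
      the Borel version \<open>c\<close> replaced by the tangential part itself on almost every
      sphere.\<close>
    have "AE r in lborel. r > 0 \<longrightarrow> ennreal (1 / r) * ?M r \<le> ?T r"
      using sph AE_sphere_measure[OF c]
    proof eventually_elim
      case (elim r)
      show ?case
      proof
        assume r: "r > 0"
        have "?T r = (\<integral>\<^sup>+x. c x \<partial>sphere_measure r)"
          using elim(2) r by (intro nn_integral_cong_AE) simp
        then show "ennreal (1 / r) * ?M r \<le> ?T r" using elim(1) r by simp
      qed
    qed
    then obtain N where N: "N \<in> null_sets lborel"
        "{r \<in> space lborel. \<not> (r > 0 \<longrightarrow> ennreal (1 / r) * ?M r \<le> ?T r)} \<subseteq> N"
      by (auto simp: eventually_ae_filter)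
    \<comment> \<open>The decay condition is applied to the null set of exceptional radii, so the
      bound of \<open>M(r) / r\<close> by \<open>?T\<close> holds at every member of the
      sequence.\<close>
    obtain Rk where Rk: "\<And>k. 0 < Rk k" "\<And>k. Rk k \<notin> N" "filterlim Rk at_top sequentially"
        "(\<lambda>k::nat. ?T (Rk k)) \<longlonglongrightarrow> 0"
      using dec N(1) by blast
    \<comment> \<open>For fixed \<open>r\<close>, eventually
      \<open>M(r) / r <= M(Rk) / Rk <= T(Rk)\<close>, and the right-hand side tends to 0.\<close>
    have M0: "?M r = 0" if r: "r > 0" for r
    proof -
      have "\<forall>\<^sub>F k in sequentially. r < Rk k"
        using Rk(3) by (simp add: filterlim_at_top_dense)
      then have "\<forall>\<^sub>F k in sequentially. ennreal (1 / r) * ?M r \<le> ?T (Rk k)"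
      proof eventually_elim
        case (elim k)
        have "ennreal (1 / r) * ?M r \<le> ennreal (1 / Rk k) * ?M (Rk k)" by (rule mono[OF r elim])
        also have "\<dots> \<le> ?T (Rk k)" using N(2) Rk(1,2)[of k] by auto
        finally show ?case .
      qed
      then have "ennreal (1 / r) * ?M r \<le> 0"
        by (intro tendsto_lowerbound[OF Rk(4)]) auto
      then show ?thesis using r by simp
    qed
    have "AE x in lborel. \<forall>n. ?q x * indicator {..<real (Suc n)} (norm x) = 0"
    proof (subst AE_all_countable, intro allI)
      fix n
      have "(\<integral>\<^sup>+x. ?q x * indicator {..<real (Suc n)} (norm x) \<partial>lborel) = 0"
        using M0[of "real (Suc n)"] by (simp add: ball_mass_def)
      then show "AE x in lborel. ?q x * indicator {..<real (Suc n)} (norm x) = 0"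
        by (subst (asm) nn_integral_0_iff_AE) measurable
    qed
    with q have "AE x in lborel. u x = 0"
    proof eventually_elim
      case (elim x)
      obtain n where "norm x < real n" using reals_Archimedean2 by blast
      then have "norm x < real (Suc n)" by simp
      then have "?q x = 0" using elim(2)[rule_format, of n] by simp
      then show ?case using elim(1) by simp
    qed
    then show "AE x in lebesgue. u x = 0" by (rule AE_completion)
  qed
qed

end
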